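(* Let $S=\{0,1\}$, let $X_n$ be the $n$th canonical projection on $S^\infty$ (with the product $\sigma$-field $\mathcal{B}^\infty$, $\mathcal{B}$ the power set of $S$), and let $P$ be a probability on $(S^\infty,\mathcal{B}^\infty)$ under which $X=(X_1,X_2,\ldots)$ is exchangeable. Let $\pi$ be the probability distribution of $\mu\{1\}$ under $P$. If $\pi$ admits an almost Lipschitz density with respect to Lebesgue measure $\lambda$ on $\mathbb{R}$, then $\sqrt{n}\,\|C_n\|$ converges $P$-a.s. to a real random variable.
   Context: $\mathcal{G}_n=\sigma(X_1,\ldots,X_n)$. For $B\subset S$: $\mu_n(B)=\frac1n\sum_{i=1}^n I_B(X_i)$; $a_n(B)=P(X_{n+1}\in B\mid\mathcal{G}_n)$; $\mu(B)=\limsup_n\mu_n(B)$; $C_n(B)=\sqrt{n}\{\mu_n(B)-a_n(B)\}$. $\|C_n\|=\max_{B\in\mathcal{D}}|C_n(B)|$, where $\mathcal{D}$ is the power set of $S$. A real function $g$ on $(0,1)$ is almost Lipschitz if $x\mapsto g(x)\,x^a(1-x)^b$ is Lipschitz on $(0,1)$ for some reals $a,b<1$. *)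

theory Defs
  imports "HOL-Probability.Probability"
begin

definition states :: "nat set" where
  "states = {0, 1}"

text \<open>
  The canonical space is indexed by the positive integers, so its points are the functions
  on \<open>{1..}\<close> with values in \<open>states\<close> that are \<open>undefined\<close> at \<open>0\<close>.
\<close>

definition seq_space :: "(nat \<Rightarrow> nat) measure" where
  "seq_space = (\<Pi>\<^sub>M i\<in>{1..}. count_space states)"

definition proj :: "nat \<Rightarrow> (nat \<Rightarrow> nat) \<Rightarrow> nat" where
  "proj n \<omega> = \<omega> n"

definition exchangeable :: "(nat \<Rightarrow> nat) measure \<Rightarrow> bool" where
  "exchangeable P \<longleftrightarrow>
     (\<forall>n p. p permutes {1..n} \<longrightarrow>
        distr P (\<Pi>\<^sub>M i\<in>{1..n}. count_space states) (\<lambda>\<omega>. \<lambda>i\<in>{1..n}. proj (p i) \<omega>) =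
        distr P (\<Pi>\<^sub>M i\<in>{1..n}. count_space states) (\<lambda>\<omega>. \<lambda>i\<in>{1..n}. proj i \<omega>))"

definition history :: "nat \<Rightarrow> (nat \<Rightarrow> nat) measure" where
  "history n =
     sigma (space seq_space) {proj i -` A \<inter> space seq_space |i A. i \<in> {1..n} \<and> A \<subseteq> states}"

definition empirical :: "nat \<Rightarrow> nat set \<Rightarrow> (nat \<Rightarrow> nat) \<Rightarrow> real" where
  "empirical n B \<omega> = (1 / real n) * (\<Sum>i=1..n. indicator B (proj i \<omega>))"

text \<open>
  \<^const>\<open>real_cond_exp\<close> selects one version of the conditional probability; it is determined
  up to a null set.
\<close>

definition predictive ::
    "(nat \<Rightarrow> nat) measure \<Rightarrow> nat \<Rightarrow> nat set \<Rightarrow> (nat \<Rightarrow> nat) \<Rightarrow> real" where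
  "predictive P n B = real_cond_exp P (history n) (\<lambda>\<omega>. indicator B (proj (n + 1) \<omega>))"

text \<open>
  The upper limit is taken in \<^typ>\<open>ereal\<close>; since the empirical frequencies lie in \<open>[0, 1]\<close>,
  it is finite and the conversion back to \<^typ>\<open>real\<close> loses nothing.
\<close>

definition limit_freq :: "nat set \<Rightarrow> (nat \<Rightarrow> nat) \<Rightarrow> real" where
  "limit_freq B \<omega> = real_of_ereal (limsup (\<lambda>n. ereal (empirical n B \<omega>)))"

definition deviation ::
    "(nat \<Rightarrow> nat) measure \<Rightarrow> nat \<Rightarrow> nat set \<Rightarrow> (nat \<Rightarrow> nat) \<Rightarrow> real" where
  "deviation P n B \<omega> = sqrt (real n) * (empirical n B \<omega> - predictive P n B \<omega>)"

definition deviation_norm :: "(nat \<Rightarrow> nat) measure \<Rightarrow> nat \<Rightarrow> (nat \<Rightarrow> nat) \<Rightarrow> real" where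
  "deviation_norm P n \<omega> = Max ((\<lambda>B. \<bar>deviation P n B \<omega>\<bar>) ` Pow states)"

text \<open>Only the restriction of \<open>g\<close> to the open unit interval matters.\<close>

definition almost_lipschitz :: "(real \<Rightarrow> real) \<Rightarrow> bool" where
  "almost_lipschitz g \<longleftrightarrow>
     (\<exists>a b L. a < 1 \<and> b < 1 \<and>
        L-lipschitz_on {0<..<1} (\<lambda>x. g x * x powr a * (1 - x) powr b))"

end

theory Submission imports Defs begin

text \<open>
  Write \<open>\<theta>\<close> for the limiting frequency of ones, \<open>\<G>\<^sub>n\<close> for the history up to time \<open>n\<close> and \<open>S\<^sub>n\<close> for the number
  of ones among the first \<open>n\<close> coordinates. The deviations for \<open>{0}\<close> and \<open>{1}\<close> are opposite and the other two
  vanish, so the claim is that \<open>n (\<mu>\<^sub>n{1} - a\<^sub>n{1})\<close> converges almost surely up to sign.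

  Exchangeability gives \<open>a\<^sub>n{1} = E[\<theta> | \<G>\<^sub>n]\<close>, and a cylinder with \<open>k\<close> ones and \<open>n - k\<close> zeros, weighted by
  \<open>\<phi>(\<theta>)\<close>, has expectation \<open>E[\<theta>\<^sup>k (1 - \<theta>)\<^bsup>n-k\<^esup> \<phi>(\<theta>)]\<close>. Let \<open>f\<close> be the density of \<open>\<theta>\<close> and let
  \<open>g(x) = f(x) x\<^sup>a (1 - x)\<^sup>b\<close> be Lipschitz. The function
  \<open>(k + 1 - a - (n + 2 - a - b) x) x\<^bsup>k-a\<^esup> (1 - x)\<^bsup>n-k-b\<^esup>\<close> is the derivative of
  \<open>x\<^bsup>k+1-a\<^esup> (1 - x)\<^bsup>n-k+1-b\<^esup>\<close>, which vanishes at both end points because \<open>a, b < 1\<close>. Integrating it by parts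
  against \<open>g\<close> gives, with the score \<open>h(x) = x (1 - x) g'(x) / g(x)\<close>,

  \<open>S\<^sub>n + 1 - a - (n + 2 - a - b) E[\<theta> | \<G>\<^sub>n] = - E[h(\<theta>) | \<G>\<^sub>n]\<close>,

  that is, \<open>n (\<mu>\<^sub>n{1} - a\<^sub>n{1}) = - E[h(\<theta>) | \<G>\<^sub>n] - (1 - a) + (2 - a - b) E[\<theta> | \<G>\<^sub>n]\<close>. Since \<open>h(\<theta>)\<close> is integrable
  and \<open>\<theta>\<close> is a function of the sequence, both conditional expectations converge by Levy's upward
  theorem. The limit is \<open>- h(\<theta>) - (1 - a) + (2 - a - b) \<theta>\<close>.

  The main ingredients are \<open>cond_exp_converges\<close> (Levy's theorem, from a maximal inequality and \<open>L\<^sup>1\<close>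
  approximation), \<open>lipschitz_weak_derivative\<close> and \<open>beta_integration_by_parts\<close> (the calculus),
  \<open>empirical_converges\<close> (the strong law for exchangeable indicators, from second moments),
  \<open>integral_cylinder\<close> (the representation of cylinders) and \<open>score_identity\<close> (the displayed formula).
\<close>

section \<open>Levy's upward theorem\<close>

text \<open>
  A filtration that generates the whole \<open>\<sigma>\<close>-algebra, so that every integrable random variable is
  the \<open>L\<^sup>1\<close> limit of variables depending on finitely much information.
\<close>

locale generating_filtration = prob_space +
  fixes F :: "nat \<Rightarrow> 'a measure"
  assumes subalg: "subalgebra M (F n)"
    and sets_mono: "m \<le> n \<Longrightarrow> sets (F m) \<subseteq> sets (F n)"
    and generates: "sets M = sigma_sets (space M) (\<Union>n. sets (F n))"
begin

lemma space_F [simp]: "space (F n) = space M"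
  using subalg unfolding subalgebra_def by auto

lemma sets_F_subset: "sets (F n) \<subseteq> sets M"
  using subalg unfolding subalgebra_def by auto

lemma finite_measure_subalgebra_F: "finite_measure_subalgebra M (F n)"
  by (intro finite_measure_subalgebra.intro finite_measure_subalgebra_axioms.intro subalg)
     (rule finite_measure_axioms)

sublocale sub: finite_measure_subalgebra M "F n" for n
  by (rule finite_measure_subalgebra_F)

lemma measurable_F_mono:
  assumes "Y \<in> borel_measurable (F m)" "m \<le> n"
  shows "Y \<in> borel_measurable (F n)"
  using assms sets_mono[OF assms(2)] by (auto simp: measurable_def)

definition approximable :: "('a \<Rightarrow> real) \<Rightarrow> bool" where
  "approximable Z \<longleftrightarrow> integrable M Z \<and>
     (\<forall>\<epsilon>>0. \<exists>m Y. Y \<in> borel_measurable (F m) \<and> integrable M Y \<and> (\<integral>\<omega>. \<bar>Z \<omega> - Y \<omega>\<bar> \<partial>M) < \<epsilon>)"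

lemma approximable_closed:
  assumes Z: "integrable M Z"
    and W: "\<And>\<epsilon>. \<epsilon> > 0 \<Longrightarrow> \<exists>W. approximable W \<and> (\<integral>\<omega>. \<bar>Z \<omega> - W \<omega>\<bar> \<partial>M) < \<epsilon>"
  shows "approximable Z"
  unfolding approximable_def
proof (intro conjI allI impI Z)
  fix \<epsilon> :: real assume "\<epsilon> > 0"
  then obtain W where W: "approximable W" "(\<integral>\<omega>. \<bar>Z \<omega> - W \<omega>\<bar> \<partial>M) < \<epsilon> / 2"
    using W[of "\<epsilon> / 2"] by auto
  from W(1) \<open>\<epsilon> > 0\<close> obtain m Y where Y: "Y \<in> borel_measurable (F m)" "integrable M Y"
      "(\<integral>\<omega>. \<bar>W \<omega> - Y \<omega>\<bar> \<partial>M) < \<epsilon> / 2"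
    unfolding approximable_def by (meson half_gt_zero)
  have iW: "integrable M W" using W(1) by (simp add: approximable_def)
  have "(\<integral>\<omega>. \<bar>Z \<omega> - Y \<omega>\<bar> \<partial>M) \<le> (\<integral>\<omega>. \<bar>Z \<omega> - W \<omega>\<bar> + \<bar>W \<omega> - Y \<omega>\<bar> \<partial>M)"
    using Z iW Y(2) by (intro integral_mono) auto
  also have "\<dots> = (\<integral>\<omega>. \<bar>Z \<omega> - W \<omega>\<bar> \<partial>M) + (\<integral>\<omega>. \<bar>W \<omega> - Y \<omega>\<bar> \<partial>M)"
    using Z iW Y(2) by (intro Bochner_Integration.integral_add) auto
  finally have "(\<integral>\<omega>. \<bar>Z \<omega> - Y \<omega>\<bar> \<partial>M) < \<epsilon>" using W(2) Y(3) by simp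
  with Y show "\<exists>m Y. Y \<in> borel_measurable (F m) \<and> integrable M Y \<and> (\<integral>\<omega>. \<bar>Z \<omega> - Y \<omega>\<bar> \<partial>M) < \<epsilon>"
    by blast
qed

lemma approximable_F_measurable:
  assumes "Y \<in> borel_measurable (F m)" "integrable M Y"
  shows "approximable Y"
  unfolding approximable_def using assms
  by (intro conjI allI impI exI[of _ m] exI[of _ Y]) auto

lemma approximable_add:
  assumes V: "approximable V" and W: "approximable W"
  shows "approximable (\<lambda>\<omega>. V \<omega> + W \<omega>)"
proof -
  have i: "integrable M V" "integrable M W" using V W by (auto simp: approximable_def)
  show ?thesis
    unfolding approximable_def
  proof (intro conjI allI impI)
    fix \<epsilon> :: real assume "\<epsilon> > 0"
    with V obtain m Y where Y: "Y \<in> borel_measurable (F m)" "integrable M Y"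
        "(\<integral>\<omega>. \<bar>V \<omega> - Y \<omega>\<bar> \<partial>M) < \<epsilon> / 2"
      unfolding approximable_def by (meson half_gt_zero)
    from W \<open>\<epsilon> > 0\<close> obtain n X where X: "X \<in> borel_measurable (F n)" "integrable M X"
        "(\<integral>\<omega>. \<bar>W \<omega> - X \<omega>\<bar> \<partial>M) < \<epsilon> / 2"
      unfolding approximable_def by (meson half_gt_zero)
    have m: "(\<lambda>\<omega>. Y \<omega> + X \<omega>) \<in> borel_measurable (F (max m n))"
      using measurable_F_mono[OF Y(1), of "max m n"] measurable_F_mono[OF X(1), of "max m n"]
      by auto
    have "(\<integral>\<omega>. \<bar>(V \<omega> + W \<omega>) - (Y \<omega> + X \<omega>)\<bar> \<partial>M) \<le> (\<integral>\<omega>. \<bar>V \<omega> - Y \<omega>\<bar> + \<bar>W \<omega> - X \<omega>\<bar> \<partial>M)"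
      using i X(2) Y(2) by (intro integral_mono) auto
    also have "\<dots> = (\<integral>\<omega>. \<bar>V \<omega> - Y \<omega>\<bar> \<partial>M) + (\<integral>\<omega>. \<bar>W \<omega> - X \<omega>\<bar> \<partial>M)"
      using i X(2) Y(2) by (intro Bochner_Integration.integral_add) auto
    finally have "(\<integral>\<omega>. \<bar>(V \<omega> + W \<omega>) - (Y \<omega> + X \<omega>)\<bar> \<partial>M) < \<epsilon>" using X(3) Y(3) by simp
    moreover have "integrable M (\<lambda>\<omega>. Y \<omega> + X \<omega>)" using X Y by auto
    ultimately show "\<exists>m Y. Y \<in> borel_measurable (F m) \<and> integrable M Y \<and>
        (\<integral>\<omega>. \<bar>V \<omega> + W \<omega> - Y \<omega>\<bar> \<partial>M) < \<epsilon>"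
      using m by blast
  qed (use i in auto)
qed

lemma approximable_cmult:
  assumes V: "approximable V"
  shows "approximable (\<lambda>\<omega>. c * V \<omega>)"
proof (cases "c = 0")
  case True
  then show ?thesis by (intro approximable_F_measurable[where m = 0]) auto
next
  case False
  show ?thesis
    unfolding approximable_def
  proof (intro conjI allI impI)
    show "integrable M (\<lambda>\<omega>. c * V \<omega>)" using V by (auto simp: approximable_def)
    fix \<epsilon> :: real assume "\<epsilon> > 0"
    with False have "\<epsilon> / \<bar>c\<bar> > 0" by simp
    with V obtain m Y where Y: "Y \<in> borel_measurable (F m)" "integrable M Y"
        "(\<integral>\<omega>. \<bar>V \<omega> - Y \<omega>\<bar> \<partial>M) < \<epsilon> / \<bar>c\<bar>"
      unfolding approximable_def by meson
    have "(\<integral>\<omega>. \<bar>c * V \<omega> - c * Y \<omega>\<bar> \<partial>M) = \<bar>c\<bar> * (\<integral>\<omega>. \<bar>V \<omega> - Y \<omega>\<bar> \<partial>M)"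
      by (simp flip: right_diff_distrib add: abs_mult)
    also have "\<dots> < \<epsilon>" using Y(3) False by (simp add: field_simps)
    finally show "\<exists>m Y. Y \<in> borel_measurable (F m) \<and> integrable M Y \<and>
        (\<integral>\<omega>. \<bar>c * V \<omega> - Y \<omega>\<bar> \<partial>M) < \<epsilon>"
      using Y(1,2) by (intro exI[of _ m] exI[of _ "\<lambda>\<omega>. c * Y \<omega>"]) auto
  qed
qed

lemma approximable_dominated_limit:
  assumes s: "\<And>i. approximable (s i)" and Z: "Z \<in> borel_measurable M"
    and lim: "\<And>\<omega>. \<omega> \<in> space M \<Longrightarrow> (\<lambda>i. s i \<omega>) \<longlonglongrightarrow> Z \<omega>"
    and w: "integrable M w" and le: "\<And>i \<omega>. \<omega> \<in> space M \<Longrightarrow> \<bar>s i \<omega>\<bar> \<le> w \<omega>"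
  shows "approximable Z"
proof -
  have ms [measurable]: "s i \<in> borel_measurable M" for i
    using s[of i] by (auto simp: approximable_def)
  have Zw: "\<bar>Z \<omega>\<bar> \<le> w \<omega>" if "\<omega> \<in> space M" for \<omega>
    using lim[OF that] le[OF that] by (intro tendsto_upperbound[OF tendsto_rabs[OF lim[OF that]]]) auto
  have iZ: "integrable M Z"
    using Zw by (intro Bochner_Integration.integrable_bound[OF w Z] AE_I2) fastforce
  have "(\<lambda>i. \<integral>\<omega>. \<bar>Z \<omega> - s i \<omega>\<bar> \<partial>M) \<longlonglongrightarrow> (\<integral>\<omega>. 0 \<partial>M)"
  proof (rule integral_dominated_convergence[where w = "\<lambda>\<omega>. 2 * w \<omega>"])
    show "AE \<omega> in M. (\<lambda>i. \<bar>Z \<omega> - s i \<omega>\<bar>) \<longlonglongrightarrow> 0"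
      using lim by (intro AE_I2 tendsto_rabs_zero) (auto intro!: tendsto_eq_intros)
    fix i
    show "AE \<omega> in M. norm \<bar>Z \<omega> - s i \<omega>\<bar> \<le> 2 * w \<omega>"
      using Zw le[of _ i] by (intro AE_I2) fastforce
  qed (use Z w in auto)
  then have lim0: "(\<lambda>i. \<integral>\<omega>. \<bar>Z \<omega> - s i \<omega>\<bar> \<partial>M) \<longlonglongrightarrow> 0" by simp
  show ?thesis
  proof (rule approximable_closed[OF iZ])
    fix \<epsilon> :: real assume "\<epsilon> > 0"
    from order_tendstoD(2)[OF lim0 this] obtain i where "(\<integral>\<omega>. \<bar>Z \<omega> - s i \<omega>\<bar> \<partial>M) < \<epsilon>"
      unfolding eventually_sequentially by auto
    with s show "\<exists>W. approximable W \<and> (\<integral>\<omega>. \<bar>Z \<omega> - W \<omega>\<bar> \<partial>M) < \<epsilon>" by blast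
  qed
qed

text \<open>
  The sets of the filtration form a generator stable under intersection, and the approximable
  indicators are closed under complements and disjoint unions, so Dynkin's theorem applies.
\<close>

lemma approximable_indicator:
  assumes "A \<in> sets M"
  shows "approximable (indicator A)"
proof -
  have stable: "Int_stable (\<Union>n. sets (F n))"
  proof (rule Int_stableI)
    fix A B assume "A \<in> (\<Union>n. sets (F n))" "B \<in> (\<Union>n. sets (F n))"
    then obtain m n where "A \<in> sets (F m)" "B \<in> sets (F n)" by auto
    then have "A \<in> sets (F (max m n))" "B \<in> sets (F (max m n))"
      using sets_mono[of m "max m n"] sets_mono[of n "max m n"] by auto
    then show "A \<inter> B \<in> (\<Union>n. sets (F n))" by blast
  qed
  have sub: "(\<Union>n. sets (F n)) \<subseteq> Pow (space M)" using sets_F_subset sets.sets_into_space by blast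
  have A: "A \<in> sigma_sets (space M) (\<Union>n. sets (F n))" using assms generates by simp
  from stable sub A show ?thesis
  proof (induction rule: sigma_sets_induct_disjoint)
    case (basic A)
    then obtain n where "A \<in> sets (F n)" by auto
    then show ?case
      using sets_F_subset[of n] by (intro approximable_F_measurable[where m = n]) (auto simp: emeasure_eq_measure)
  next
    case empty
    show ?case by (intro approximable_F_measurable[where m = 0]) auto
  next
    case (compl A)
    have one: "approximable (\<lambda>\<omega>. 1)" by (intro approximable_F_measurable[where m = 0]) auto
    have m: "indicator (space M - A) \<in> borel_measurable M"
      using compl(1) by (auto simp flip: generates)
    show ?case
    proof (rule approximable_dominated_limit[where s = "\<lambda>_. \<lambda>\<omega>. 1 + (-1) * indicator A \<omega>" and w = "\<lambda>_. 2"])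
      show "approximable (\<lambda>\<omega>. 1 + - 1 * indicator A \<omega>)"
        by (intro approximable_add one approximable_cmult compl)
    qed (rule m, auto simp: indicator_def)
  next
    case (union A)
    have Am: "A i \<in> sets M" for i using union(2) generates by auto
    have fin: "approximable (\<lambda>\<omega>. \<Sum>i<k. indicator (A i) \<omega>)" for k
    proof (induction k)
      case 0
      show ?case by (intro approximable_F_measurable[where m = 0]) auto
    next
      case (Suc k)
      then show ?case using approximable_add[OF Suc union(3)[of k]] by simp
    qed
    have eq: "(\<Sum>i<k. indicator (A i) \<omega>) = (indicator (\<Union>i<k. A i) \<omega> :: real)" for k \<omega>
      by (rule indicator_UN_disjoint[symmetric])
         (use union(1) in \<open>auto simp: disjoint_family_on_def\<close>)
    show ?case
    proof (rule approximable_dominated_limit[where s = "\<lambda>k \<omega>. \<Sum>i<k. indicator (A i) \<omega>" and w = "\<lambda>_. 1"])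
      show "(\<lambda>k. \<Sum>i<k. indicator (A i) \<omega>) \<longlonglongrightarrow> (indicator (\<Union>(range A)) \<omega> :: real)" for \<omega>
        unfolding eq using LIMSEQ_indicator_UN[of A \<omega>] by simp
      show "\<bar>\<Sum>i<k. indicator (A i) \<omega>\<bar> \<le> (1 :: real)" for k \<omega>
        unfolding eq by (simp add: indicator_def)
      show "indicator (\<Union>(range A)) \<in> borel_measurable M" using Am by auto
    qed (use fin in auto)
  qed
qed

lemma integrable_imp_approximable:
  assumes "integrable M Z"
  shows "approximable Z"
  using assms
proof (induction rule: integrable_induct)
  case (base A c)
  then show ?case using approximable_cmult[OF approximable_indicator[of A], of c] by (simp add: mult.commute)
next
  case (add f g)
  then show ?case by (intro approximable_add)
next
  case (lim f s)
  then show ?case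
    by (intro approximable_dominated_limit[of s f "\<lambda>\<omega>. 2 * \<bar>f \<omega>\<bar>"]) auto
qed

text \<open>
  Doob's argument: cut the event according to the first \<open>n\<close> at which the bound \<open>\<epsilon>\<close> is exceeded. The
  piece \<open>A n\<close> lies in \<open>F n\<close>, so on it the conditional expectation may be replaced by \<open>Z\<close>, and the
  pieces are disjoint.
\<close>

lemma cond_exp_maximal_inequality:
  assumes Z: "integrable M Z" and \<epsilon>: "\<epsilon> > 0"
  shows "\<P>(\<omega> in M. \<exists>n. \<epsilon> < \<bar>real_cond_exp M (F n) Z \<omega>\<bar>) \<le> (\<integral>\<omega>. \<bar>Z \<omega>\<bar> \<partial>M) / \<epsilon>"
proof -
  define E where "E n = real_cond_exp M (F n) Z" for n
  define A where "A n = {\<omega> \<in> space M. \<epsilon> < \<bar>E n \<omega>\<bar> \<and> (\<forall>k<n. \<not> \<epsilon> < \<bar>E k \<omega>\<bar>)}" for n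
  have mE: "E k \<in> borel_measurable (F n)" if "k \<le> n" for k n
    unfolding E_def by (rule measurable_F_mono[OF borel_measurable_cond_exp that])
  have AF: "A n \<in> sets (F n)" for n
  proof -
    have "Measurable.pred (F n) (\<lambda>\<omega>. \<epsilon> < \<bar>E k \<omega>\<bar>)" if "k \<le> n" for k
      using mE[OF that] by simp
    then have "Measurable.pred (F n) (\<lambda>\<omega>. \<forall>k\<in>{..<n}. \<not> \<epsilon> < \<bar>E k \<omega>\<bar>)"
      by (intro pred_intros_finite pred_intros_logic) auto
    moreover have "Measurable.pred (F n) (\<lambda>\<omega>. \<epsilon> < \<bar>E n \<omega>\<bar>)" using mE[of n n] by simp
    ultimately have "Measurable.pred (F n) (\<lambda>\<omega>. \<epsilon> < \<bar>E n \<omega>\<bar> \<and> (\<forall>k\<in>{..<n}. \<not> \<epsilon> < \<bar>E k \<omega>\<bar>))"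
      by (intro pred_intros_logic)
    then have "{\<omega> \<in> space (F n). \<epsilon> < \<bar>E n \<omega>\<bar> \<and> (\<forall>k\<in>{..<n}. \<not> \<epsilon> < \<bar>E k \<omega>\<bar>)} \<in> sets (F n)"
      by (simp only: pred_def)
    then show ?thesis by (simp add: A_def Ball_def)
  qed
  then have AM [measurable]: "A n \<in> sets M" for n using sets_F_subset by auto
  have disj: "disjoint_family A"
    unfolding disjoint_family_on_def A_def by (auto, metis linorder_neqE_nat)
  have un: "{\<omega> \<in> space M. \<exists>n. \<epsilon> < \<bar>E n \<omega>\<bar>} = (\<Union>n. A n)"
  proof (intro set_eqI iffI)
    fix \<omega> assume "\<omega> \<in> {\<omega> \<in> space M. \<exists>n. \<epsilon> < \<bar>E n \<omega>\<bar>}"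
    then have "\<omega> \<in> space M" and ex: "\<exists>n. \<epsilon> < \<bar>E n \<omega>\<bar>" by auto
    then have "\<omega> \<in> A (LEAST n. \<epsilon> < \<bar>E n \<omega>\<bar>)"
      unfolding A_def using LeastI_ex[OF ex] not_less_Least[of _ "\<lambda>n. \<epsilon> < \<bar>E n \<omega>\<bar>"] by blast
    then show "\<omega> \<in> (\<Union>n. A n)" by blast
  qed (auto simp: A_def)
  have iA: "integrable M (\<lambda>\<omega>. indicator (A n) \<omega> * \<bar>Z \<omega>\<bar>)" for n
    using integrable_mult_indicator[OF AM, of "\<lambda>\<omega>. \<bar>Z \<omega>\<bar>"] Z by simp
  have bound: "\<epsilon> * prob (A n) \<le> (\<integral>\<omega>. indicator (A n) \<omega> * \<bar>Z \<omega>\<bar> \<partial>M)" for n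
  proof -
    have iE: "integrable M (E n)" unfolding E_def using Z by (rule sub.real_cond_exp_int)
    \<comment> \<open>The sign is known at time \<open>n\<close>, so it turns \<open>E n\<close> into its absolute value under the integral.\<close>
    let ?s = "\<lambda>\<omega>. indicator (A n) \<omega> * sgn (E n \<omega>)"
    have ms: "?s \<in> borel_measurable (F n)" using mE[of n n] AF by auto
    have iZs: "integrable M (\<lambda>\<omega>. ?s \<omega> * Z \<omega>)"
      using Z measurable_from_subalg[OF subalg ms]
      by (intro Bochner_Integration.integrable_bound[OF Z]) (auto simp: abs_mult indicator_def sgn_if)
    have "\<epsilon> * prob (A n) = (\<integral>\<omega>. \<epsilon> * indicator (A n) \<omega> \<partial>M)" by simp
    also have "\<dots> \<le> (\<integral>\<omega>. ?s \<omega> * E n \<omega> \<partial>M)"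
    proof (rule integral_mono)
      show "integrable M (\<lambda>\<omega>. ?s \<omega> * E n \<omega>)"
        unfolding E_def by (rule sub.real_cond_exp_intg) (use iZs ms Z in \<open>auto simp: E_def\<close>)
      show "\<epsilon> * indicator (A n) \<omega> \<le> ?s \<omega> * E n \<omega>" for \<omega>
        by (auto simp: indicator_def A_def sgn_if split: if_splits)
    qed (auto simp: emeasure_eq_measure)
    also have "\<dots> = (\<integral>\<omega>. ?s \<omega> * Z \<omega> \<partial>M)"
      unfolding E_def by (rule sub.real_cond_exp_intg) (use iZs ms Z in \<open>auto simp: E_def\<close>)
    also have "\<dots> \<le> (\<integral>\<omega>. indicator (A n) \<omega> * \<bar>Z \<omega>\<bar> \<partial>M)"
      by (rule integral_mono[OF iZs iA]) (auto simp: indicator_def sgn_if)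
    finally show ?thesis .
  qed
  have part: "(\<Sum>n<N. prob (A n)) \<le> (\<integral>\<omega>. \<bar>Z \<omega>\<bar> \<partial>M) / \<epsilon>" for N
  proof -
    have "\<epsilon> * (\<Sum>n<N. prob (A n)) \<le> (\<Sum>n<N. \<integral>\<omega>. indicator (A n) \<omega> * \<bar>Z \<omega>\<bar> \<partial>M)"
      unfolding sum_distrib_left by (intro sum_mono bound)
    also have "\<dots> = (\<integral>\<omega>. (\<Sum>n<N. indicator (A n) \<omega> * \<bar>Z \<omega>\<bar>) \<partial>M)"
      by (rule Bochner_Integration.integral_sum[symmetric]) (rule iA)
    also have "\<dots> \<le> (\<integral>\<omega>. \<bar>Z \<omega>\<bar> \<partial>M)"
    proof (rule integral_mono)
      fix \<omega>
      have "(\<Sum>n<N. indicator (A n) \<omega> * \<bar>Z \<omega>\<bar>) = indicator (\<Union>n<N. A n) \<omega> * \<bar>Z \<omega>\<bar>"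
        by (subst indicator_UN_disjoint)
           (use disj in \<open>auto simp: disjoint_family_on_def sum_distrib_right\<close>)
      also have "\<dots> \<le> \<bar>Z \<omega>\<bar>" by (simp add: indicator_def)
      finally show "(\<Sum>n<N. indicator (A n) \<omega> * \<bar>Z \<omega>\<bar>) \<le> \<bar>Z \<omega>\<bar>" .
      show "integrable M (\<lambda>\<omega>. \<Sum>n<N. indicator (A n) \<omega> * \<bar>Z \<omega>\<bar>)"
        by (intro Bochner_Integration.integrable_sum iA)
    qed (use Z in auto)
    finally show ?thesis using \<epsilon> by (simp add: field_simps)
  qed
  have "(\<lambda>n. prob (A n)) sums prob (\<Union>n. A n)"
    by (rule finite_measure_UNION[OF _ disj]) auto
  then have "prob (\<Union>n. A n) \<le> (\<integral>\<omega>. \<bar>Z \<omega>\<bar> \<partial>M) / \<epsilon>"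
    using part by (metis LIMSEQ_le_const2 sums_def)
  then show ?thesis using un by (simp add: E_def)
qed

text \<open>
  Levy's upward theorem. If \<open>Y\<close> is known at time \<open>m\<close>, then from time \<open>m\<close> on the error of the conditional
  expectation of \<open>Z\<close> equals that of \<open>D = Z - Y\<close>. When \<open>Y\<close> is close to \<open>Z\<close> in \<open>L\<^sup>1\<close>, both \<open>D\<close> and all its
  conditional expectations are uniformly small outside an event of small probability, by Markov's
  inequality and the maximal inequality.
\<close>

theorem cond_exp_converges:
  assumes Z: "integrable M Z"
  shows "AE \<omega> in M. (\<lambda>n. real_cond_exp M (F n) Z \<omega>) \<longlonglongrightarrow> Z \<omega>"
proof -
  define E where "E n = real_cond_exp M (F n) Z" for n
  have [measurable]: "E n \<in> borel_measurable M" for n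
    unfolding E_def by (rule borel_measurable_cond_exp2)
  have [measurable]: "Z \<in> borel_measurable M" using Z by auto
  have close: "AE \<omega> in M. eventually (\<lambda>n. \<bar>E n \<omega> - Z \<omega>\<bar> \<le> 2 * \<epsilon>) sequentially" if \<epsilon>: "\<epsilon> > 0" for \<epsilon>
  proof -
    let ?N = "{\<omega> \<in> space M. \<not> eventually (\<lambda>n. \<bar>E n \<omega> - Z \<omega>\<bar> \<le> 2 * \<epsilon>) sequentially}"
    have N [measurable]: "?N \<in> sets M" unfolding eventually_sequentially by measurable
    have small: "prob ?N \<le> 2 * \<delta>" if \<delta>: "\<delta> > 0" for \<delta>
    proof -
      from integrable_imp_approximable[OF Z] mult_pos_pos[OF \<delta> \<epsilon>] obtain m Y
        where Y: "Y \<in> borel_measurable (F m)" "integrable M Y" "(\<integral>\<omega>. \<bar>Z \<omega> - Y \<omega>\<bar> \<partial>M) < \<delta> * \<epsilon>"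
        unfolding approximable_def by meson
      define D where "D \<omega> = Z \<omega> - Y \<omega>" for \<omega>
      have D: "integrable M D" unfolding D_def using Z Y by auto
      have [measurable]: "D \<in> borel_measurable M" using D by auto
      let ?B = "{\<omega> \<in> space M. \<exists>n. \<epsilon> < \<bar>real_cond_exp M (F n) D \<omega>\<bar>}"
      let ?C = "{\<omega> \<in> space M. \<epsilon> \<le> \<bar>D \<omega>\<bar>}"
      have [measurable]: "real_cond_exp M (F n) D \<in> borel_measurable M" for n
        by (rule borel_measurable_cond_exp2)
      have B: "prob ?B \<le> \<delta>"
      proof -
        have "prob ?B \<le> (\<integral>\<omega>. \<bar>D \<omega>\<bar> \<partial>M) / \<epsilon>" by (rule cond_exp_maximal_inequality[OF D \<epsilon>])
        also have "\<dots> \<le> \<delta>" using Y(3) \<epsilon> by (simp add: D_def field_simps)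
        finally show ?thesis .
      qed
      have C: "prob ?C \<le> \<delta>"
      proof -
        have "prob ?C \<le> (\<integral>\<omega>. \<bar>D \<omega>\<bar> \<partial>M) / \<epsilon>"
          using integral_Markov_inequality_measure[of M "\<lambda>\<omega>. \<bar>D \<omega>\<bar>" "{}" \<epsilon>] D \<epsilon> by auto
        also have "\<dots> \<le> \<delta>" using Y(3) \<epsilon> by (simp add: D_def field_simps)
        finally show ?thesis .
      qed
      have "AE \<omega> in M. \<forall>n\<ge>m. E n \<omega> = real_cond_exp M (F n) D \<omega> + Y \<omega>"
      proof (subst AE_all_countable, intro allI)
        fix n
        show "AE \<omega> in M. n \<ge> m \<longrightarrow> E n \<omega> = real_cond_exp M (F n) D \<omega> + Y \<omega>"
        proof (cases "n \<ge> m")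
          case True
          have "AE \<omega> in M. real_cond_exp M (F n) Y \<omega> = Y \<omega>"
            by (rule sub.real_cond_exp_F_meas[OF Y(2) measurable_F_mono[OF Y(1) True]])
          moreover have "AE \<omega> in M. real_cond_exp M (F n) D \<omega> = E n \<omega> - real_cond_exp M (F n) Y \<omega>"
            unfolding E_def D_def by (rule sub.real_cond_exp_diff[OF Z Y(2)])
          ultimately show ?thesis by eventually_elim simp
        qed simp
      qed
      then have "AE \<omega> in M. \<omega> \<in> ?N \<longrightarrow> \<omega> \<in> ?B \<union> ?C"
      proof eventually_elim
        case (elim \<omega>)
        show ?case
        proof (rule impI, rule ccontr)
          assume N: "\<omega> \<in> ?N" and "\<omega> \<notin> ?B \<union> ?C"
          then have b: "\<bar>real_cond_exp M (F n) D \<omega>\<bar> \<le> \<epsilon>" "\<bar>D \<omega>\<bar> \<le> \<epsilon>" for n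
            by (auto simp: not_less not_le intro: less_imp_le)
          have "\<forall>n\<ge>m. \<bar>E n \<omega> - Z \<omega>\<bar> \<le> 2 * \<epsilon>"
          proof (intro allI impI)
            fix n assume "m \<le> n"
            with elim have "E n \<omega> - Z \<omega> = real_cond_exp M (F n) D \<omega> - D \<omega>" by (simp add: D_def)
            then show "\<bar>E n \<omega> - Z \<omega>\<bar> \<le> 2 * \<epsilon>" using b(1)[of n] b(2) by linarith
          qed
          with N show False unfolding eventually_sequentially by auto
        qed
      qed
      then have "prob ?N \<le> prob (?B \<union> ?C)" by (rule finite_measure_mono_AE) measurable
      also have "\<dots> \<le> prob ?B + prob ?C" by (rule measure_Un_le) measurable
      finally show ?thesis using B C by simp
    qed
    have "prob ?N \<le> 0"
    proof (rule field_le_epsilon)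
      fix e :: real assume "e > 0"
      then show "prob ?N \<le> 0 + e" using small[of "e / 2"] by simp
    qed
    then have "prob ?N = 0" using measure_nonneg[of M ?N] by linarith
    then have "?N \<in> null_sets M" using N by (auto simp: emeasure_eq_measure null_sets_def)
    then have "AE \<omega> in M. \<omega> \<notin> ?N" by (rule AE_not_in)
    then show ?thesis by (rule AE_mp) auto
  qed
  have "AE \<omega> in M. \<forall>k. eventually (\<lambda>n. \<bar>E n \<omega> - Z \<omega>\<bar> \<le> 2 * inverse (real (Suc k))) sequentially"
    by (subst AE_all_countable) (intro allI close, simp)
  then show ?thesis
  proof eventually_elim
    case (elim \<omega>)
    show ?case
    proof (rule tendstoI)
      fix e :: real assume "e > 0"
      then obtain k where k: "inverse (real (Suc k)) < e / 2" using reals_Archimedean[of "e / 2"] by auto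
      from elim[rule_format, of k] show "eventually (\<lambda>n. dist (real_cond_exp M (F n) Z \<omega>) (Z \<omega>) < e) sequentially"
        by eventually_elim (use k in \<open>auto simp: E_def dist_real_def\<close>)
    qed
  qed
qed

end

section \<open>Weak derivatives and integration by parts against Beta weights\<close>

lemma lipschitz_on_extend_UNIV:
  fixes g :: "real \<Rightarrow> real"
  assumes "L-lipschitz_on {0<..<1} g"
  obtains g' where "L-lipschitz_on UNIV g'" "\<And>x. 0 < x \<Longrightarrow> x < 1 \<Longrightarrow> g' x = g x"
proof -
  from lipschitz_extend_closure[OF assms] obtain e
    where e: "L-lipschitz_on {0..1} e" "\<And>x. x \<in> {0<..<1} \<Longrightarrow> e x = g x"
    by auto
  define clamp :: "real \<Rightarrow> real" where "clamp x = max 0 (min 1 x)" for x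
  show thesis
  proof (rule that[of "\<lambda>x. e (clamp x)"])
    show "L-lipschitz_on UNIV (\<lambda>x. e (clamp x))"
    proof (rule lipschitz_onI)
      fix x y :: real
      have "dist (e (clamp x)) (e (clamp y)) \<le> L * dist (clamp x) (clamp y)"
        by (rule lipschitz_onD[OF e(1)]) (auto simp: clamp_def)
      also have "\<dots> \<le> L * dist x y"
        by (rule mult_left_mono[OF _ lipschitz_on_nonneg[OF e(1)]]) (auto simp: clamp_def dist_real_def)
      finally show "dist (e (clamp x)) (e (clamp y)) \<le> L * dist x y" .
    qed (rule lipschitz_on_nonneg[OF e(1)])
    show "e (clamp x) = g x" if "0 < x" "x < 1" for x
      using e(2)[of x] that by (auto simp: clamp_def)
  qed
qed

text \<open>
  A Lipschitz function is the integral of a density, obtained here without differentiating. The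
  function \<open>G x = g x + (L + 1) x\<close> expands distances, so it is a bijection of the line with Lipschitz
  inverse \<open>H\<close>. The image \<open>m\<close> of Lebesgue measure under \<open>H\<close> gives \<open>{x..y}\<close> the mass \<open>G y - G x\<close>, and it is
  absolutely continuous because \<open>G\<close> maps null sets to null sets; subtracting \<open>L + 1\<close> from its
  Radon-Nikodym density gives a density for \<open>g\<close>.

  On the zeros of \<open>g\<close> the map \<open>G\<close> is the dilation by \<open>L + 1\<close>, so \<open>m\<close> is \<open>L + 1\<close> times Lebesgue measure
  there, and the density of \<open>g\<close> may be set to zero at these points. This is what later allows
  division by \<open>g\<close>.
\<close>

lemma lipschitz_weak_derivative:
  fixes g :: "real \<Rightarrow> real"
  assumes lip: "L-lipschitz_on UNIV g"
  obtains d :: "real \<Rightarrow> real" where "d \<in> borel_measurable borel"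
    "\<And>x y. set_integrable lborel {x..y} d"
    "\<And>x y. x \<le> y \<Longrightarrow> set_lebesgue_integral lborel {x..y} d = g y - g x"
    "\<And>x. g x = 0 \<Longrightarrow> d x = 0"
proof -
  have L: "L \<ge> 0" by (rule lipschitz_on_nonneg[OF lip])
  have gL: "\<bar>g x - g y\<bar> \<le> L * \<bar>x - y\<bar>" for x y
    using lipschitz_onD[OF lip, of x y] by (simp add: dist_real_def)
  have contg: "continuous_on UNIV g"
    by (rule lipschitz_on_continuous_on[OF lip])
  have mg [measurable]: "g \<in> borel_measurable borel"
    by (rule borel_measurable_continuous_onI[OF contg])
  define G where "G x = g x + (L + 1) * x" for x
  have expand: "y - x \<le> G y - G x" if "x \<le> y" for x y
    using gL[of x y] that L by (auto simp: G_def algebra_simps abs_le_iff)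
  have Gle: "G x \<le> G y \<longleftrightarrow> x \<le> y" for x y
    using expand[of x y] expand[of y x] by linarith
  have Gexp: "\<bar>x - y\<bar> \<le> \<bar>G x - G y\<bar>" for x y
    using expand[of x y] expand[of y x] by linarith
  have contG: "continuous_on A G" for A
    unfolding G_def by (intro continuous_intros continuous_on_subset[OF contg]) auto
  have surj: "\<exists>x. G x = u" for u
  proof -
    have "G (- \<bar>u - G 0\<bar>) \<le> u" "u \<le> G \<bar>u - G 0\<bar>"
      using expand[of 0 "\<bar>u - G 0\<bar>"] expand[of "- \<bar>u - G 0\<bar>" 0] by linarith+
    then show ?thesis using IVT'[of G "- \<bar>u - G 0\<bar>" u "\<bar>u - G 0\<bar>"] contG by auto
  qed
  define H where "H u = (SOME x. G x = u)" for u
  have GH: "G (H u) = u" for u unfolding H_def by (rule someI_ex[OF surj])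
  have HG: "H (G x) = x" for x using Gexp[of "H (G x)" x] GH[of "G x"] by simp
  have Hlip: "1-lipschitz_on UNIV H"
  proof (rule lipschitz_onI)
    show "dist (H u) (H v) \<le> 1 * dist u v" for u v
      using Gexp[of "H u" "H v"] by (simp add: GH dist_real_def)
  qed simp
  have mH [measurable]: "H \<in> borel_measurable borel"
    by (rule borel_measurable_continuous_onI[OF lipschitz_on_continuous_on[OF Hlip]])
  define m where "m = distr lborel borel H"
  have setsm [simp, measurable_cong]: "sets m = sets lborel" by (simp add: m_def)
  have m_eq: "emeasure m A = emeasure lborel (H -` A)" if "A \<in> sets borel" for A
    using that by (simp add: m_def emeasure_distr)
  have vim: "H -` A = G ` A" for A
    using GH HG by (auto simp: image_iff) metis
  have ac: "absolutely_continuous lborel m"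
    unfolding absolutely_continuous_def
  proof
    fix A assume A: "A \<in> null_sets (lborel :: real measure)"
    then have "negligible A" by (simp add: negligible_iff_null_sets null_sets_completionI)
    have "negligible (G ` A)"
    proof (rule negligible_locally_Lipschitz_image[OF _ \<open>negligible A\<close>])
      fix x
      show "\<exists>T B. open T \<and> x \<in> T \<and> (\<forall>y\<in>A \<inter> T. norm (G y - G x) \<le> B * norm (y - x))"
      proof (intro exI[of _ UNIV] exI[of _ "2 * L + 1"] conjI ballI)
        fix y
        have "\<bar>G y - G x\<bar> \<le> \<bar>g y - g x\<bar> + \<bar>(L + 1) * (y - x)\<bar>"
          by (simp add: G_def algebra_simps)
        also have "\<dots> \<le> (2 * L + 1) * \<bar>y - x\<bar>"
        proof -
          have "\<bar>(L + 1) * (y - x)\<bar> = (L + 1) * \<bar>y - x\<bar>" using L by (simp add: abs_mult)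
          moreover have "(2 * L + 1) * \<bar>y - x\<bar> = L * \<bar>y - x\<bar> + (L + 1) * \<bar>y - x\<bar>"
            by (simp only: ring_distribs)
          ultimately show ?thesis using gL[of y x] by linarith
        qed
        finally show "norm (G y - G x) \<le> (2 * L + 1) * norm (y - x)" by simp
      qed auto
    qed auto
    moreover have "H -` A \<in> sets borel" using A measurable_sets[OF mH, of A] by auto
    ultimately have "emeasure lborel (H -` A) = 0"
      unfolding vim[symmetric] using negligible_iff_emeasure0[of "H -` A"] by auto
    moreover have "A \<in> sets borel" using A by auto
    ultimately show "A \<in> null_sets m" using m_eq[of A] by (intro null_setsI) auto
  qed
  from sigma_finite_measure.Radon_Nikodym[OF sigma_finite_lborel ac] obtain r
    where r [measurable]: "r \<in> borel_measurable borel" and dens: "density lborel r = m" by auto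
  have rA: "(\<integral>\<^sup>+x. r x * indicator A x \<partial>lborel) = emeasure m A" if "A \<in> sets borel" for A
    using that by (simp add: dens[symmetric] emeasure_density)
  define \<rho> where "\<rho> x = enn2real (r x)" for x
  have [measurable]: "\<rho> \<in> borel_measurable borel" unfolding \<rho>_def by measurable
  have real_r: "set_integrable lborel A \<rho>" "set_lebesgue_integral lborel A \<rho> = c"
    if A [measurable]: "A \<in> sets borel" and c: "emeasure m A = ennreal c" "c \<ge> 0" for A c
  proof -
    have fin: "(\<integral>\<^sup>+x. r x * indicator A x \<partial>lborel) = ennreal c" using rA[OF A] c by simp
    have "AE x in lborel. r x * indicator A x \<noteq> \<infinity>"
      by (rule nn_integral_PInf_AE) (use fin in auto)
    then have "AE x in lborel. ennreal (indicator A x * \<rho> x) = r x * indicator A x"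
      by eventually_elim (auto simp: \<rho>_def indicator_def less_top split: if_splits)
    then have nn: "(\<integral>\<^sup>+x. ennreal (indicator A x * \<rho> x) \<partial>lborel) = ennreal c"
      using fin by (subst nn_integral_cong_AE) auto
    have "has_bochner_integral lborel (\<lambda>x. indicator A x * \<rho> x) c"
      by (rule has_bochner_integral_nn_integral[OF _ _ c(2) nn]) (auto simp: \<rho>_def)
    then show "set_integrable lborel A \<rho>" "set_lebesgue_integral lborel A \<rho> = c"
      by (auto simp: set_integrable_def set_lebesgue_integral_def has_bochner_integral_iff)
  qed
  have mIcc: "emeasure m {x..y} = ennreal (G y - G x)" if "x \<le> y" for x y
  proof -
    have "x \<le> H u \<longleftrightarrow> G x \<le> u" "H u \<le> y \<longleftrightarrow> u \<le> G y" for u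
      using Gle[of x "H u"] Gle[of "H u" y] by (simp_all add: GH)
    then have "H -` {x..y} = {G x..G y}" by auto
    then show ?thesis using that Gle[of x y] by (simp add: m_eq)
  qed
  let ?Z = "{x. g x = 0}"
  have Zm [measurable]: "?Z \<in> sets borel" by measurable
  have mZ: "emeasure m ({x..y} \<inter> ?Z) = ennreal ((L + 1) * measure lborel ({x..y} \<inter> ?Z))" for x y
  proof -
    let ?A = "{x..y} \<inter> ?Z"
    have "G ` ?A = (\<lambda>x. (L + 1) * x) ` ?A" by (intro image_cong) (auto simp: G_def)
    also have "\<dots> = (\<lambda>x. x / (L + 1)) -` ?A"
    proof -
      have "(\<lambda>x. c * x) ` S = (\<lambda>x. x / c) -` S" if "c \<noteq> 0" for c :: real and S
        using that by (auto intro: rev_image_eqI)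
      then show ?thesis using L by simp
    qed
    finally have v: "H -` ?A = (\<lambda>x. x / (L + 1)) -` ?A" by (simp only: vim)
    have "emeasure lborel ((\<lambda>x. x / (L + 1)) -` ?A) = emeasure (distr lborel borel ((*) (1 / (L + 1)))) ?A"
      by (subst emeasure_distr) (auto simp: vimage_def)
    also have "\<dots> = ennreal (L + 1) * emeasure lborel ?A"
      using L by (subst lborel_distr_mult) (auto simp: emeasure_density nn_integral_cmult_indicator)
    also have "\<dots> = ennreal ((L + 1) * measure lborel ?A)"
    proof -
      have "emeasure lborel ?A \<le> emeasure lborel {x..y}" by (rule emeasure_mono) auto
      also have "\<dots> < \<infinity>" by (simp add: emeasure_lborel_Icc_eq)
      finally show ?thesis using L by (subst emeasure_eq_ennreal_measure) (auto simp: ennreal_mult)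
    qed
    finally show ?thesis using m_eq[of ?A] v by simp
  qed
  define d where "d x = (if g x = 0 then 0 else \<rho> x - (L + 1))" for x
  have md: "d \<in> borel_measurable borel" unfolding d_def by measurable
  have cst: "set_integrable lborel A (\<lambda>_. L + 1)" "set_lebesgue_integral lborel A (\<lambda>_. L + 1) = (L + 1) * measure lborel A"
    if A [measurable]: "A \<in> sets borel" and sub: "A \<subseteq> {x..y}" for A and x y :: real
  proof -
    have "emeasure lborel A \<le> emeasure lborel {x..y}" by (rule emeasure_mono[OF sub]) auto
    also have "\<dots> < \<infinity>" by (simp add: emeasure_lborel_Icc_eq)
    finally show "set_integrable lborel A (\<lambda>_. L + 1)"
      "set_lebesgue_integral lborel A (\<lambda>_. L + 1) = (L + 1) * measure lborel A"
      by (auto simp: set_integrable_def set_lebesgue_integral_def)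
  qed
  have int_d: "set_integrable lborel {x..y} d \<and> set_lebesgue_integral lborel {x..y} d = g y - g x"
    if xy: "x \<le> y" for x y
  proof -
    have Gxy: "0 \<le> G y - G x" using Gle[of x y] xy by simp
    note 1 = real_r[OF _ mIcc[OF xy] Gxy]
    note 2 = real_r[OF _ mZ[of x y]]
    have c: "set_integrable lborel {x..y} (\<lambda>t. \<rho> t - (L + 1))"
      "set_lebesgue_integral lborel {x..y} (\<lambda>t. \<rho> t - (L + 1)) = g y - g x"
      using 1 cst[of "{x..y}" x y] xy by (auto simp: G_def algebra_simps)
    have z: "set_integrable lborel ({x..y} \<inter> ?Z) (\<lambda>t. \<rho> t - (L + 1))"
      "set_lebesgue_integral lborel ({x..y} \<inter> ?Z) (\<lambda>t. \<rho> t - (L + 1)) = 0"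
      using 2 cst[of "{x..y} \<inter> ?Z" x y] L by auto
    have eq: "indicator {x..y} t *\<^sub>R d t = indicator {x..y} t *\<^sub>R (\<rho> t - (L + 1)) -
        indicator ({x..y} \<inter> ?Z) t *\<^sub>R (\<rho> t - (L + 1))" for t
      by (auto simp: d_def indicator_def)
    show ?thesis
      unfolding set_integrable_def set_lebesgue_integral_def eq
      using c z unfolding set_integrable_def set_lebesgue_integral_def
      by auto
  qed
  show thesis
  proof (rule that[OF md])
    show "set_integrable lborel {x..y} d" for x y
    proof (cases "x \<le> y")
      case False
      then show ?thesis by (simp add: set_integrable_def)
    qed (use int_d in blast)
  qed (use int_d in \<open>auto simp: d_def\<close>)
qed


text \<open>
  The weight is the derivative of \<open>x powr p * (1 - x) powr q\<close>, written as the unnormalized Beta density with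
  parameters \<open>p\<close> and \<open>q\<close> times a factor that is affine in \<open>x\<close>.
\<close>

lemma beta_weight_integral:
  fixes p q :: real
  assumes p: "p > 0" and q: "q > 0"
  defines "w \<equiv> \<lambda>x. (p - (p + q) * x) * (x powr (p - 1) * (1 - x) powr (q - 1))"
  shows "set_integrable lborel {0..1} w"
    and "\<And>t. 0 \<le> t \<Longrightarrow> t \<le> 1 \<Longrightarrow> set_lebesgue_integral lborel {t..1} w = - (t powr p * (1 - t) powr q)"
proof -
  have [measurable]: "w \<in> borel_measurable borel" unfolding w_def by measurable
  show int: "set_integrable lborel {0..1} w"
    unfolding set_integrable_def
  proof (rule Bochner_Integration.integrable_bound)
    show "integrable lborel (\<lambda>x. (p + q) * (indicator {0..1} x *\<^sub>R (x powr (p - 1) * (1 - x) powr (q - 1))))"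
      using integrable_Beta[OF p q] unfolding set_integrable_def by (rule integrable_mult_right)
    have "\<bar>w x\<bar> \<le> (p + q) * (x powr (p - 1) * (1 - x) powr (q - 1))" if "0 \<le> x" "x \<le> 1" for x
    proof -
      have "0 \<le> (p + q) * x" "(p + q) * x \<le> p + q"
        using that p q by (auto intro!: mult_left_le)
      then have "\<bar>p - (p + q) * x\<bar> \<le> p + q" using p q unfolding abs_le_iff minus_diff_eq by (intro conjI) argo+
      then show ?thesis by (auto simp: w_def abs_mult intro!: mult_right_mono)
    qed
    then show "AE x in lborel. norm (indicator {0..1} x *\<^sub>R w x)
        \<le> norm ((p + q) * (indicator {0..1} x *\<^sub>R (x powr (p - 1) * (1 - x) powr (q - 1))))"
      using p q by (intro AE_I2) (auto simp: indicator_def)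
  qed auto
  fix t :: real assume t: "0 \<le> t" "t \<le> 1"
  let ?W = "\<lambda>x::real. x powr p * (1 - x) powr q"
  have "(w has_integral (?W 1 - ?W t)) {t..1}"
  proof (rule fundamental_theorem_of_calculus_interior[OF t(2)])
    show "continuous_on {t..1} ?W"
      by (intro continuous_intros continuous_on_powr') (use t p q in auto)
    fix x assume x: "x \<in> {t<..<1}"
    have "(?W has_real_derivative p * x powr (p - 1) * (1 - x) powr q + x powr p * (q * (1 - x) powr (q - 1) * (-1))) (at x)"
      using x t by (auto intro!: derivative_eq_intros)
    moreover have "x powr p = x * x powr (p - 1)" "(1 - x) powr q = (1 - x) * (1 - x) powr (q - 1)"
      using x t by (simp_all add: powr_mult_base)
    ultimately have "(?W has_real_derivative w x) (at x)"
      by (simp add: w_def algebra_simps)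
    then show "(?W has_vector_derivative w x) (at x)"
      by (simp add: has_real_derivative_iff_has_vector_derivative)
  qed
  moreover have "set_integrable lborel {t..1} w"
    by (rule set_integrable_subset[OF int]) (use t in auto)
  ultimately show "set_lebesgue_integral lborel {t..1} w = - ?W t"
    using q by (simp add: set_borel_integral_eq_integral(2) integral_unique)
qed

text \<open>
  Writing \<open>g x - g 0\<close> as the integral of \<open>d\<close> over \<open>{0..x}\<close> and exchanging the integrals replaces the
  weight by its integral over \<open>{t..1}\<close>, computed above. The constant \<open>g 0\<close> contributes nothing because
  the weight integrates to zero over the unit interval.
\<close>

lemma beta_integration_by_parts:
  fixes p q :: real and g d :: "real \<Rightarrow> real"
  assumes p: "p > 0" and q: "q > 0"
    and d [measurable]: "d \<in> borel_measurable borel"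
    and int_d: "\<And>x. set_integrable lborel {0..x} d"
    and ftc: "\<And>x. 0 \<le> x \<Longrightarrow> set_lebesgue_integral lborel {0..x} d = g x - g 0"
  shows "set_integrable lborel {0..1} (\<lambda>x. x powr p * (1 - x) powr q * d x)"
    and "set_lebesgue_integral lborel {0..1}
           (\<lambda>x. (p - (p + q) * x) * (x powr (p - 1) * (1 - x) powr (q - 1)) * g x) =
         - set_lebesgue_integral lborel {0..1} (\<lambda>x. x powr p * (1 - x) powr q * d x)"
proof -
  define w where "w x = (p - (p + q) * x) * (x powr (p - 1) * (1 - x) powr (q - 1))" for x
  define W where "W x = x powr p * (1 - x) powr q" for x
  have [measurable]: "w \<in> borel_measurable borel" "W \<in> borel_measurable borel"
    unfolding w_def W_def by measurable
  have iw: "set_integrable lborel {0..1} w" unfolding w_def by (rule beta_weight_integral(1)[OF p q])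
  have tail: "set_lebesgue_integral lborel {t..1} w = - W t" if "0 \<le> t" "t \<le> 1" for t
    unfolding w_def W_def by (rule beta_weight_integral(2)[OF p q that])
  have W1: "\<bar>W x\<bar> \<le> 1" if "0 \<le> x" "x \<le> 1" for x
  proof -
    have "x powr p \<le> 1 powr p" "(1 - x) powr q \<le> 1 powr q"
      using that p q by (intro powr_mono2; simp)+
    then show ?thesis by (auto simp: W_def abs_mult intro!: mult_le_one)
  qed
  have "set_integrable lborel {0..1} (\<lambda>x. W x * d x)"
    unfolding set_integrable_def
  proof (rule Bochner_Integration.integrable_bound)
    show "integrable lborel (\<lambda>x. indicator {0..1} x *\<^sub>R d x)"
      using int_d[of 1] by (simp add: set_integrable_def)
    show "AE x in lborel. norm (indicator {0..1} x *\<^sub>R (W x * d x)) \<le> norm (indicator {0..1} x *\<^sub>R d x)"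
      using W1 by (intro AE_I2) (auto simp: indicator_def abs_mult intro!: mult_left_le_one_le)
  qed auto
  then show "set_integrable lborel {0..1} (\<lambda>x. x powr p * (1 - x) powr q * d x)"
    by (simp only: W_def)
  \<comment> \<open>\<open>K\<close> is supported on \<open>0 \<le> t \<le> x \<le> 1\<close>; its two iterated integrals are the two sides.\<close>
  define K where "K x t = (indicator {0..1} x * w x) * (indicator {0..x} t * d t)" for x t
  have Kmeas [measurable]: "case_prod K \<in> borel_measurable (lborel \<Otimes>\<^sub>M lborel)"
  proof -
    have "case_prod K = (\<lambda>z. (indicator {0..1} (fst z) * w (fst z)) * (if 0 \<le> snd z \<and> snd z \<le> fst z then d (snd z) else 0))"
      by (auto simp: K_def fun_eq_iff)
    then show ?thesis by simp
  qed
  have Kint: "integrable (lborel \<Otimes>\<^sub>M lborel) (case_prod K)"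
  proof (rule Bochner_Integration.integrable_bound)
    show "integrable (lborel \<Otimes>\<^sub>M lborel) (\<lambda>(x, t). (indicator {0..1} x * w x) * (indicator {0..1} t * d t))"
    proof (rule lborel_pair.Fubini_integrable)
      have "integrable lborel (\<lambda>x. \<bar>indicator {0..1} x * w x\<bar> * (\<integral>t. \<bar>indicator {0..1} t * d t\<bar> \<partial>lborel))"
        using iw by (intro integrable_mult_left integrable_abs) (simp add: set_integrable_def)
      then show "integrable lborel (\<lambda>x. \<integral>t. norm (case (x, t) of (x, t) \<Rightarrow>
          (indicator {0..1} x * w x) * (indicator {0..1} t * d t)) \<partial>lborel)"
        by (simp only: prod.case real_norm_def abs_mult[of "_ * w _"] integral_mult_right_zero)
    qed (use int_d[of 1] in \<open>auto simp: set_integrable_def\<close>)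
    show "AE z in lborel \<Otimes>\<^sub>M lborel. norm (case_prod K z) \<le>
        norm (case z of (x, t) \<Rightarrow> (indicator {0..1} x * w x) * (indicator {0..1} t * d t))"
      by (intro AE_I2) (auto simp: K_def indicator_def)
  qed simp
  have inner_t: "(\<integral>t. K x t \<partial>lborel) = indicator {0..1} x * (w x * g x) - g 0 * (indicator {0..1} x * w x)" for x
  proof -
    have "(\<integral>t. K x t \<partial>lborel) = (indicator {0..1} x * w x) * set_lebesgue_integral lborel {0..x} d"
      by (simp only: K_def set_lebesgue_integral_def integral_mult_right_zero real_scaleR_def)
    also have "\<dots> = indicator {0..1} x * (w x * g x) - g 0 * (indicator {0..1} x * w x)"
    proof (cases "x \<in> {0..1}")
      case True
      then have "set_lebesgue_integral lborel {0..x} d = g x - g 0" using ftc[of x] by simp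
      then show ?thesis using True by (simp only:) (simp add: algebra_simps)
    qed simp
    finally show ?thesis .
  qed
  have inner_x: "(\<integral>x. K x t \<partial>lborel) = - (indicator {0..1} t * (W t * d t))" for t
  proof (cases "t \<in> {0..1}")
    case True
    have "(\<integral>x. K x t \<partial>lborel) = (\<integral>x. d t * (indicator {t..1} x *\<^sub>R w x) \<partial>lborel)"
      by (rule Bochner_Integration.integral_cong) (use True in \<open>auto simp: K_def indicator_def\<close>)
    also have "\<dots> = d t * set_lebesgue_integral lborel {t..1} w"
      by (simp add: set_lebesgue_integral_def)
    finally show ?thesis using True tail[of t] by simp
  next
    case False
    then have "K x t = 0" for x by (auto simp: K_def indicator_def)
    then show ?thesis using False by simp
  qed
  have wg: "integrable lborel (\<lambda>x. indicator {0..1} x * (w x * g x) - g 0 * (indicator {0..1} x * w x))"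
    using lborel_pair.integrable_fst[OF Kint] by (simp add: inner_t)
  have iw': "integrable lborel (\<lambda>x. g 0 * (indicator {0..1} x * w x))"
    using iw by (simp add: set_integrable_def)
  have iwg: "integrable lborel (\<lambda>x. indicator {0..1} x * (w x * g x))"
    using Bochner_Integration.integrable_add[OF wg iw'] by simp
  have w0: "(\<integral>x. g 0 * (indicator {0..1} x * w x) \<partial>lborel) = 0"
    using tail[of 0] p by (simp add: set_lebesgue_integral_def W_def)
  have "(\<integral>x. indicator {0..1} x * (w x * g x) \<partial>lborel) = (\<integral>x. \<integral>t. K x t \<partial>lborel \<partial>lborel)"
    unfolding inner_t using w0 Bochner_Integration.integral_diff[OF iwg iw'] by simp
  also have "\<dots> = (\<integral>t. \<integral>x. K x t \<partial>lborel \<partial>lborel)"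
    by (rule lborel_pair.Fubini_integral[OF Kint, symmetric])
  also have "\<dots> = - (\<integral>t. indicator {0..1} t * (W t * d t) \<partial>lborel)"
    unfolding inner_x by simp
  finally show "set_lebesgue_integral lborel {0..1}
      (\<lambda>x. (p - (p + q) * x) * (x powr (p - 1) * (1 - x) powr (q - 1)) * g x) =
      - set_lebesgue_integral lborel {0..1} (\<lambda>x. x powr p * (1 - x) powr q * d x)"
    by (simp add: set_lebesgue_integral_def w_def W_def mult.assoc)
qed


text \<open>
  Let \<open>g x = f x * x powr a * (1 - x) powr b\<close> with weak derivative \<open>d\<close>. Up to the factor \<open>g\<close>, the
  product of \<open>x ^ k * (1 - x) ^ l\<close> with \<open>f\<close> is a Beta weight with parameters \<open>p = k + 1 - a\<close> and
  \<open>q = l + 1 - b\<close>, which are positive because \<open>a, b < 1\<close>, and \<open>h x = x * (1 - x) * d x / g x\<close> is the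
  score that appears when integrating by parts. The division is harmless since \<open>d\<close> vanishes
  wherever \<open>g\<close> does.
\<close>

lemma almost_lipschitz_score:
  fixes f :: "real \<Rightarrow> real"
  assumes f [measurable]: "f \<in> borel_measurable borel" and f0: "\<And>x. 0 \<le> f x"
    and a: "a < 1" and b: "b < 1"
    and lip: "L-lipschitz_on {0<..<1} (\<lambda>x. f x * x powr a * (1 - x) powr b)"
    and supp: "AE x in density lborel (\<lambda>x. ennreal (f x)). x \<in> {0..1}"
  shows "\<exists>h :: real \<Rightarrow> real. h \<in> borel_measurable borel \<and>
    integrable (density lborel (\<lambda>x. ennreal (f x))) h \<and>
    (\<forall>k l :: nat. (\<integral>x. x ^ k * (1 - x) ^ l * (real k + 1 - a - (real (k + l) + 2 - a - b) * x) \<partial>density lborel (\<lambda>x. ennreal (f x)))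
       = - (\<integral>x. x ^ k * (1 - x) ^ l * h x \<partial>density lborel (\<lambda>x. ennreal (f x))))"
proof -
  let ?D = "density lborel (\<lambda>x. ennreal (f x))"
  from lipschitz_on_extend_UNIV[OF lip] obtain g where g: "L-lipschitz_on UNIV g"
    and gf: "\<And>x. 0 < x \<Longrightarrow> x < 1 \<Longrightarrow> g x = f x * x powr a * (1 - x) powr b" by blast
  have mg [measurable]: "g \<in> borel_measurable borel"
    by (rule borel_measurable_continuous_onI[OF lipschitz_on_continuous_on[OF g]])
  from lipschitz_weak_derivative[OF g] obtain d where d [measurable]: "d \<in> borel_measurable borel"
    and int_d: "\<And>x y. set_integrable lborel {x..y} d"
    and ftc: "\<And>x y. x \<le> y \<Longrightarrow> set_lebesgue_integral lborel {x..y} d = g y - g x"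
    and d0: "\<And>x. g x = 0 \<Longrightarrow> d x = 0" by blast
  define h where "h x = x * (1 - x) * d x / g x" for x
  have mh [measurable]: "h \<in> borel_measurable borel" unfolding h_def by measurable
  have "AE x in lborel. 0 < f x \<longrightarrow> x \<in> {0..1}"
    using supp by (subst (asm) AE_density) auto
  moreover have "AE x in lborel. x \<noteq> (0::real)" "AE x in lborel. x \<noteq> (1::real)"
    by (rule AE_lborel_singleton)+
  ultimately have fx: "AE x in lborel. f x = indicator {0..1} x * (g x * x powr (- a) * (1 - x) powr (- b))
      \<and> (x \<in> {0..1} \<longrightarrow> 0 < x \<and> x < 1)"
  proof eventually_elim
    case (elim x)
    show ?case
    proof (cases "x \<in> {0..1}")
      case True
      with elim have x: "0 < x" "x < 1" by auto
      then have "x powr a * x powr (- a) = 1" "(1 - x) powr b * (1 - x) powr (- b) = 1"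
        by (simp_all add: powr_minus)
      then have "g x * x powr (- a) * (1 - x) powr (- b) = f x"
        by (simp add: gf[OF x] algebra_simps)
      then show ?thesis using True x by simp
    qed (use elim f0[of x] in auto)
  qed
  have pw: "x powr (- c) * x ^ k = x powr (real k + 1 - c - 1)"
    "x powr (- c) * (x * x ^ k) = x powr (real k + 1 - c)" if "0 < x" for x c :: real and k
  proof -
    show "x powr (- c) * x ^ k = x powr (real k + 1 - c - 1)"
      using that by (simp add: powr_realpow[symmetric] powr_add[symmetric])
    have "real k + 1 - c = - c + real (Suc k)" by simp
    then show "x powr (- c) * (x * x ^ k) = x powr (real k + 1 - c)"
      using that by (simp only: powr_add powr_realpow power_Suc)
  qed
  have lhs: "AE x in lborel. f x * (x ^ k * (1 - x) ^ l * (real k + 1 - a - (real (k + l) + 2 - a - b) * x)) =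
      indicator {0..1} x * ((p - (p + q) * x) * (x powr (p - 1) * (1 - x) powr (q - 1)) * g x)"
    if "p = real k + 1 - a" "q = real l + 1 - b" for k l p q
    using fx
  proof eventually_elim
    case (elim x)
    show ?case
    proof (cases "x \<in> {0..1}")
      case True
      with elim have x: "0 < x" "0 < 1 - x" and f: "f x = g x * x powr (- a) * (1 - x) powr (- b)" by auto
      have "p - (p + q) * x = real k + 1 - a - (real (k + l) + 2 - a - b) * x"
        by (simp add: that algebra_simps)
      then show ?thesis
        using True unfolding f that pw(1)[OF x(1), symmetric] pw(1)[OF x(2), symmetric] by simp
    qed (use elim in simp)
  qed
  have rhs: "AE x in lborel. f x * (x ^ k * (1 - x) ^ l * h x) =
      indicator {0..1} x * (x powr p * (1 - x) powr q * d x)"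
    if "p = real k + 1 - a" "q = real l + 1 - b" for k l p q
    using fx
  proof eventually_elim
    case (elim x)
    show ?case
    proof (cases "x \<in> {0..1}")
      case True
      with elim have x: "0 < x" "0 < 1 - x" and f: "f x = g x * x powr (- a) * (1 - x) powr (- b)" by auto
      have "g x * h x = x * (1 - x) * d x" using d0[of x] by (simp add: h_def)
      then show ?thesis
        using True unfolding f that pw(2)[OF x(1), symmetric] pw(2)[OF x(2), symmetric] by simp
    qed (use elim in simp)
  qed
  note parts = beta_integration_by_parts[OF _ _ d int_d ftc]
  have toD: "(\<integral>x. \<phi> x \<partial>?D) = (\<integral>x. f x * \<phi> x \<partial>lborel)" if "\<phi> \<in> borel_measurable borel" for \<phi> :: "real \<Rightarrow> real"
    using that f0 by (subst integral_density) auto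
  show ?thesis
  proof (intro exI[of _ h] conjI allI mh)
    \<comment> \<open>Integrability of \<open>h\<close> is the case \<open>k = l = 0\<close> of the integrability obtained from integration by parts.\<close>
    have "integrable lborel (\<lambda>x. f x * (x ^ 0 * (1 - x) ^ 0 * h x))"
      using parts(1)[of "1 - a" "1 - b"] a b rhs[OF refl refl, of 0 0]
      by (subst integrable_cong_AE[OF _ _ rhs[OF refl refl]]) (auto simp: set_integrable_def)
    then show "integrable ?D h" using f0 by (subst integrable_density) auto
    fix k l :: nat
    define p q where "p = real k + 1 - a" and "q = real l + 1 - b"
    have pq: "0 < p" "0 < q" using a b by (auto simp: p_def q_def)
    have "(\<integral>x. x ^ k * (1 - x) ^ l * (real k + 1 - a - (real (k + l) + 2 - a - b) * x) \<partial>?D) =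
        set_lebesgue_integral lborel {0..1} (\<lambda>x. (p - (p + q) * x) * (x powr (p - 1) * (1 - x) powr (q - 1)) * g x)"
      unfolding set_lebesgue_integral_def real_scaleR_def
      by (subst toD, measurable) (intro integral_cong_AE lhs p_def q_def; measurable)
    also have "\<dots> = - set_lebesgue_integral lborel {0..1} (\<lambda>x. x powr p * (1 - x) powr q * d x)"
      by (rule parts(2)[OF pq]) auto
    also have "set_lebesgue_integral lborel {0..1} (\<lambda>x. x powr p * (1 - x) powr q * d x) =
        (\<integral>x. x ^ k * (1 - x) ^ l * h x \<partial>?D)"
      unfolding set_lebesgue_integral_def real_scaleR_def
      by (subst toD, measurable) (intro integral_cong_AE AE_symmetric[OF rhs] p_def q_def; measurable)
    finally show "(\<integral>x. x ^ k * (1 - x) ^ l * (real k + 1 - a - (real (k + l) + 2 - a - b) * x) \<partial>?D) =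
        - (\<integral>x. x ^ k * (1 - x) ^ l * h x \<partial>?D)" .
  qed
qed

section \<open>The strong law for exchangeable binary sequences\<close>

definition swap_coords :: "nat \<Rightarrow> nat \<Rightarrow> (nat \<Rightarrow> nat) \<Rightarrow> nat \<Rightarrow> nat" where
  "swap_coords a b \<omega> = \<omega> \<circ> Transposition.transpose a b"

definition heads :: "nat \<Rightarrow> (nat \<Rightarrow> nat) \<Rightarrow> real" where
  "heads i \<omega> = indicator {1} (\<omega> i)"

lemma heads_bounds: "0 \<le> heads i \<omega>" "heads i \<omega> \<le> 1"
  by (simp_all add: heads_def)

lemma empirical_heads: "empirical n {1} \<omega> = (\<Sum>i=1..n. heads i \<omega>) / real n"
  by (simp add: empirical_def heads_def proj_def)

lemma empirical_bounds: "0 \<le> empirical n {1} \<omega> \<and> empirical n {1} \<omega> \<le> 1"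
  unfolding empirical_heads using sum_bounded_above[of "{1..n}" "\<lambda>i. heads i \<omega>" 1] heads_bounds
  by (cases "n = 0") (auto simp: divide_le_eq intro!: sum_nonneg divide_nonneg_nonneg)

lemma heads_swap_coords: "heads i (swap_coords a b \<omega>) = heads (Transposition.transpose a b i) \<omega>"
  by (simp add: heads_def swap_coords_def)

definition freq :: "(nat \<Rightarrow> nat) \<Rightarrow> real" where
  "freq = limit_freq {1}"

text \<open>
  Exchanging two coordinates leaves all empirical means from \<open>max a b\<close> on unchanged, hence also their
  upper limit.
\<close>

lemma freq_swap_coords:
  assumes "a \<ge> 1" "b \<ge> 1"
  shows "freq (swap_coords a b \<omega>) = freq \<omega>"
proof -
  have eq: "empirical n {1} (swap_coords a b \<omega>) = empirical n {1} \<omega>" if "n \<ge> max a b" for n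
  proof -
    have "Transposition.transpose a b permutes {1..n}"
      using assms that by (intro permutes_swap_id) auto
    then show ?thesis
      unfolding empirical_heads heads_swap_coords
      using sum.permute[of "Transposition.transpose a b" "{1..n}" "\<lambda>i. heads i \<omega>"] by (simp add: o_def)
  qed
  have "eventually (\<lambda>n. ereal (empirical n {1} (swap_coords a b \<omega>)) = ereal (empirical n {1} \<omega>)) sequentially"
    using eventually_ge_at_top[of "max a b"] by eventually_elim (rule arg_cong[OF eq])
  then show ?thesis unfolding freq_def limit_freq_def by (simp only: Limsup_eq)
qed

lemma empirical_change:
  assumes "1 \<le> m" "m \<le> n"
  shows "\<bar>empirical n {1} \<omega> - empirical m {1} \<omega>\<bar> \<le> (real n - real m) / real m"
proof -
  define S where "S k = (\<Sum>i=1..k. heads i \<omega>)" for k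
  have Sb: "0 \<le> S k \<and> S k \<le> real k" for k
    unfolding S_def using heads_bounds sum_nonneg[of "{1..k}" "\<lambda>i. heads i \<omega>"]
      sum_bounded_above[of "{1..k}" "\<lambda>i. heads i \<omega>" 1] by auto
  have d: "0 \<le> S n - S m \<and> S n - S m \<le> real n - real m"
  proof -
    have "{1..n} = {1..m} \<union> {Suc m..n}" "{1..m} \<inter> {Suc m..n} = {}" using assms by auto
    then have "S n = S m + (\<Sum>i=Suc m..n. heads i \<omega>)"
      unfolding S_def by (simp add: sum.union_disjoint)
    moreover have "(\<Sum>i=Suc m..n. heads i \<omega>) \<le> real (card {Suc m..n}) * 1"
      by (rule sum_bounded_above) (rule heads_bounds)
    moreover have "0 \<le> (\<Sum>i=Suc m..n. heads i \<omega>)" by (intro sum_nonneg heads_bounds)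
    ultimately show ?thesis using assms by (auto simp: of_nat_diff)
  qed
  have pos: "real m > 0" "real n > 0" using assms by auto
  have "S n / real n - S m / real m = (S n - S m) / real n - S m * (real n - real m) / (real n * real m)"
    using pos by (simp add: field_simps)
  moreover have "(S n - S m) / real n \<le> (real n - real m) / real m"
    using d assms pos by (intro frac_le) auto
  moreover have "S m * (real n - real m) / (real n * real m) \<le> (real n - real m) / real m"
  proof -
    have "S m * (real n - real m) / (real n * real m) \<le> real n * (real n - real m) / (real n * real m)"
      using Sb[of m] assms pos by (intro divide_right_mono mult_right_mono) auto
    then show ?thesis using pos by simp
  qed
  moreover have "0 \<le> (S n - S m) / real n" "0 \<le> S m * (real n - real m) / (real n * real m)"
    using d Sb[of m] assms pos by auto
  ultimately show ?thesis unfolding empirical_heads S_def[symmetric] abs_le_iff by linarith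
qed

text \<open>
  Between consecutive cubes the index grows by a factor tending to 1, so the empirical frequencies
  cannot move much there. Cubes, rather than squares, make the increments in the law of large
  numbers below summable in mean with integer exponents only.
\<close>

lemma empirical_convergent_of_cubes:
  assumes conv: "convergent (\<lambda>j. empirical (Suc j ^ 3) {1} \<omega>)"
  shows "(\<lambda>n. empirical n {1} \<omega>) \<longlonglongrightarrow> freq \<omega>"
proof -
  from conv obtain l where l: "(\<lambda>j. empirical (Suc j ^ 3) {1} \<omega>) \<longlonglongrightarrow> l" by (auto simp: convergent_def)
  have gap: "(\<lambda>j. (real (Suc (Suc j) ^ 3) - real (Suc j ^ 3)) / real (Suc j ^ 3)) \<longlonglongrightarrow> 0"
    by real_asymp
  have lim: "(\<lambda>n. empirical n {1} \<omega>) \<longlonglongrightarrow> l"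
  proof (rule LIMSEQ_I)
    fix e :: real assume "e > 0"
    then have "e / 2 > 0" by simp
    from LIMSEQ_D[OF l this] obtain J1 where
      J1: "\<And>j. j \<ge> J1 \<Longrightarrow> \<bar>empirical (Suc j ^ 3) {1} \<omega> - l\<bar> < e / 2" by (auto simp: real_norm_def)
    from LIMSEQ_D[OF gap \<open>e / 2 > 0\<close>] obtain J2 where
      J2: "\<And>j. j \<ge> J2 \<Longrightarrow> (real (Suc (Suc j) ^ 3) - real (Suc j ^ 3)) / real (Suc j ^ 3) < e / 2"
      by (auto simp: real_norm_def abs_less_iff)
    define J where "J = max J1 J2"
    show "\<exists>N. \<forall>n\<ge>N. norm (empirical n {1} \<omega> - l) < e"
    proof (intro exI allI impI)
      fix n assume n: "n \<ge> Suc J ^ 3"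
      \<comment> \<open>The largest cube below \<open>n\<close>.\<close>
      define k where "k = (GREATEST k. k ^ 3 \<le> n)"
      have bnd: "y ^ 3 \<le> n \<Longrightarrow> y \<le> n" for y :: nat
        using self_le_power[of y 3] by (cases "y = 0") auto
      have k: "k ^ 3 \<le> n" unfolding k_def by (rule GreatestI_nat[of "\<lambda>k. k ^ 3 \<le> n", OF n bnd])
      have kJ: "Suc J \<le> k" unfolding k_def by (rule Greatest_le_nat[of "\<lambda>k. k ^ 3 \<le> n", OF n bnd])
      have k': "n < Suc k ^ 3"
      proof (rule ccontr)
        assume "\<not> n < Suc k ^ 3"
        then have "Suc k ^ 3 \<le> n" by simp
        then have "Suc k \<le> k" unfolding k_def by (rule Greatest_le_nat[of "\<lambda>k. k ^ 3 \<le> n", OF _ bnd])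
        then show False by simp
      qed
      from kJ obtain j where j: "k = Suc j" "J \<le> j" by (cases k) auto
      have "\<bar>empirical n {1} \<omega> - empirical (Suc j ^ 3) {1} \<omega>\<bar> \<le> (real n - real (Suc j ^ 3)) / real (Suc j ^ 3)"
        using k j by (intro empirical_change) auto
      also have "\<dots> \<le> (real (Suc (Suc j) ^ 3) - real (Suc j ^ 3)) / real (Suc j ^ 3)"
        using k' j by (intro divide_right_mono) (auto simp del: power_Suc of_nat_power of_nat_Suc)
      also have "\<dots> < e / 2" using J2[of j] j by (simp add: J_def)
      finally show "norm (empirical n {1} \<omega> - l) < e"
        using J1[of j] j unfolding real_norm_def J_def by arith
    qed
  qed
  then have "(\<lambda>n. ereal (empirical n {1} \<omega>)) \<longlonglongrightarrow> ereal l" by simp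
  then have "limsup (\<lambda>n. ereal (empirical n {1} \<omega>)) = ereal l"
    by (intro lim_imp_Limsup) auto
  then have "freq \<omega> = l" by (simp add: freq_def limit_freq_def)
  then show ?thesis using lim by simp
qed

locale exchangeable_sequence = prob_space P for P :: "(nat \<Rightarrow> nat) measure" +
  assumes sets_P: "sets P = sets seq_space" and exch: "exchangeable P"
begin

lemma space_P: "space P = ({1..} \<rightarrow>\<^sub>E states)"
  using sets_eq_imp_space_eq[OF sets_P] by (simp add: seq_space_def space_PiM)

lemma space_seq_space: "space seq_space = space P"
  using sets_eq_imp_space_eq[OF sets_P] by simp

lemma coord_measurable: "i \<ge> 1 \<Longrightarrow> (\<lambda>\<omega>. \<omega> i) \<in> P \<rightarrow>\<^sub>M count_space states"
  unfolding measurable_cong_sets[OF sets_P refl] seq_space_def by simp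

lemma heads_measurable [measurable]:
  assumes "i \<ge> 1" shows "heads i \<in> borel_measurable P"
  unfolding heads_def using measurable_compose[OF coord_measurable[OF assms], of "indicator {1}" borel] by simp

lemma empirical_measurable [measurable]: "(\<lambda>\<omega>. empirical n {1} \<omega>) \<in> borel_measurable P"
  unfolding empirical_heads by (intro borel_measurable_divide borel_measurable_sum heads_measurable) auto

lemma freq_measurable [measurable]: "freq \<in> borel_measurable P"
  unfolding freq_def limit_freq_def by measurable

lemma swap_coords_space:
  assumes "a \<ge> 1" "b \<ge> 1" "\<omega> \<in> space P"
  shows "swap_coords a b \<omega> \<in> space P"
  using assms by (auto simp: space_P swap_coords_def Transposition.transpose_def PiE_iff extensional_def)

lemma swap_coords_measurable:
  assumes "a \<ge> 1" "b \<ge> 1"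
  shows "swap_coords a b \<in> P \<rightarrow>\<^sub>M P"
proof -
  have "swap_coords a b \<in> P \<rightarrow>\<^sub>M seq_space"
    unfolding seq_space_def
  proof (rule measurable_PiM_single')
    show "swap_coords a b \<in> space P \<rightarrow> (\<Pi>\<^sub>E i\<in>{1..}. space (count_space states))"
      using swap_coords_space[OF assms] by (auto simp: space_P)
    fix i :: nat assume "i \<in> {1..}"
    then have "Transposition.transpose a b i \<ge> 1" using assms by (auto simp: Transposition.transpose_def)
    then show "(\<lambda>\<omega>. swap_coords a b \<omega> i) \<in> P \<rightarrow>\<^sub>M count_space states"
      using coord_measurable by (simp add: swap_coords_def)
  qed
  then show ?thesis using measurable_cong_sets[OF refl sets_P] by blast
qed

text \<open>
  Exchangeability speaks about finitely many coordinates at a time. A measure on the sequence space is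
  determined by its finite-dimensional distributions, so the swap preserves the law of the whole
  sequence. This makes it possible to swap coordinates in expectations that also involve the limiting
  frequency.
\<close>

lemma distr_swap_coords:
  assumes ab: "a \<ge> 1" "b \<ge> 1"
  shows "distr P P (swap_coords a b) = P"
proof (rule measure_eqI_PiM_infinite[where I = "{1..}" and M = "\<lambda>_. count_space states"])
  let ?t = "Transposition.transpose a b"
  show "sets (distr P P (swap_coords a b)) = sets (\<Pi>\<^sub>M i\<in>{1..}. count_space states)"
    "sets P = sets (\<Pi>\<^sub>M i\<in>{1..}. count_space states)"
    by (simp_all add: sets_P seq_space_def)
  show "finite_measure (distr P P (swap_coords a b))"
    by (intro finite_measure_distr swap_coords_measurable ab)
  fix A :: "nat \<Rightarrow> nat set" and J assume J: "finite J" "J \<subseteq> {1..}"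
    and A: "\<And>i. i \<in> J \<Longrightarrow> A i \<in> sets (count_space states)"
  let ?E = "prod_emb {1..} (\<lambda>_. count_space states) J (Pi\<^sub>E J A)"
  obtain n where "J \<union> {a, b} \<subseteq> {..n}"
    using J(1) finite_nat_iff_bounded_le[of "J \<union> {a, b}"] by auto
  then have sub: "J \<subseteq> {1..n}" "a \<in> {1..n}" "b \<in> {1..n}"
    using J(2) ab by (auto simp: subset_iff)
  have t: "?t permutes {1..n}" using sub by (intro permutes_swap_id) auto
  let ?M = "\<Pi>\<^sub>M i\<in>{1..n}. count_space states"
  let ?B = "{f \<in> space ?M. \<forall>i\<in>J. f i \<in> A i}"
  have B: "?B \<in> sets ?M"
  proof -
    have "?B = prod_emb {1..n} (\<lambda>_. count_space states) J (Pi\<^sub>E J A)"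
      using sub by (auto simp: prod_emb_def space_PiM restrict_PiE_iff)
    also have "\<dots> \<in> sets ?M" using sub J A by (intro sets_PiM_I) auto
    finally show ?thesis .
  qed
  have meas: "(\<lambda>\<omega>. \<lambda>i\<in>{1..n}. proj (p i) \<omega>) \<in> P \<rightarrow>\<^sub>M ?M" if "p permutes {1..n}" for p
  proof (rule measurable_restrict)
    fix i assume "i \<in> {1..n}"
    then have "p i \<in> {1..n}" using permutes_in_image[OF that] by simp
    then show "(\<lambda>\<omega>. proj (p i) \<omega>) \<in> P \<rightarrow>\<^sub>M count_space states"
      using coord_measurable by (simp add: proj_def)
  qed
  have E: "?E = {\<omega> \<in> space P. \<forall>i\<in>J. \<omega> i \<in> A i}"
    using J by (auto simp: prod_emb_def space_P restrict_PiE_iff)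
  have Es: "?E \<in> sets P"
    unfolding sets_P seq_space_def using J A by (intro sets_PiM_I) auto
  have "emeasure (distr P P (swap_coords a b)) ?E = emeasure P (swap_coords a b -` ?E \<inter> space P)"
    by (rule emeasure_distr[OF swap_coords_measurable[OF ab] Es])
  also have "swap_coords a b -` ?E \<inter> space P = (\<lambda>\<omega>. \<lambda>i\<in>{1..n}. proj (?t i) \<omega>) -` ?B \<inter> space P"
  proof -
    have "(\<lambda>i\<in>{1..n}. proj (?t i) \<omega>) \<in> space ?M" if "\<omega> \<in> space P" for \<omega>
      using measurable_space[OF meas[OF t] that] .
    then show ?thesis
      unfolding E using swap_coords_space[OF ab] sub
      by (auto simp: swap_coords_def proj_def subset_iff)
  qed
  also have "emeasure P \<dots> = emeasure (distr P ?M (\<lambda>\<omega>. \<lambda>i\<in>{1..n}. proj (?t i) \<omega>)) ?B"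
    by (rule emeasure_distr[OF meas[OF t] B, symmetric])
  also have "\<dots> = emeasure (distr P ?M (\<lambda>\<omega>. \<lambda>i\<in>{1..n}. proj i \<omega>)) ?B"
    using exch t unfolding exchangeable_def by simp
  also have "\<dots> = emeasure P ((\<lambda>\<omega>. \<lambda>i\<in>{1..n}. proj i \<omega>) -` ?B \<inter> space P)"
    using emeasure_distr[OF meas[of id] B] by (simp add: permutes_id)
  also have "(\<lambda>\<omega>. \<lambda>i\<in>{1..n}. proj i \<omega>) -` ?B \<inter> space P = ?E"
  proof -
    have "(\<lambda>i\<in>{1..n}. proj i \<omega>) \<in> space ?M" if "\<omega> \<in> space P" for \<omega>
      using measurable_space[OF meas[of id] that] by (simp add: permutes_id)
    then show ?thesis
      unfolding E using sub by (auto simp: proj_def subset_iff)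
  qed
  finally show "emeasure (distr P P (swap_coords a b)) ?E = emeasure P ?E" .
qed

lemma integral_swap_coords:
  fixes f :: "(nat \<Rightarrow> nat) \<Rightarrow> real"
  assumes "a \<ge> 1" "b \<ge> 1" "f \<in> borel_measurable P"
  shows "(\<integral>\<omega>. f (swap_coords a b \<omega>) \<partial>P) = (\<integral>\<omega>. f \<omega> \<partial>P)"
  using integral_distr[OF swap_coords_measurable[OF assms(1,2)] assms(3)] distr_swap_coords[OF assms(1,2)] by simp

lemma integrable_heads_mult:
  assumes W: "integrable P W" and i: "i \<ge> 1"
  shows "integrable P (\<lambda>\<omega>. heads i \<omega> * W \<omega>)"
proof (rule Bochner_Integration.integrable_bound[OF W])
  show "AE \<omega> in P. norm (heads i \<omega> * W \<omega>) \<le> norm (W \<omega>)"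
    by (intro AE_I2) (simp add: abs_mult mult_left_le_one_le heads_bounds)
qed (use W heads_measurable[OF i] in measurable)

definition pair_moment :: "nat \<Rightarrow> nat \<Rightarrow> real" where
  "pair_moment i j = (\<integral>\<omega>. heads i \<omega> * heads j \<omega> \<partial>P)"

lemma integrable_heads_pair: "i \<ge> 1 \<Longrightarrow> j \<ge> 1 \<Longrightarrow> integrable P (\<lambda>\<omega>. heads i \<omega> * heads j \<omega>)"
  using integrable_heads_mult[of "\<lambda>_. 1" j] integrable_heads_mult[of "heads j" i] by simp

lemma pair_moment_transpose:
  assumes "a \<ge> 1" "b \<ge> 1" "i \<ge> 1" "j \<ge> 1"
  shows "pair_moment (Transposition.transpose a b i) (Transposition.transpose a b j) = pair_moment i j"
  unfolding pair_moment_def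
  using integral_swap_coords[OF assms(1,2), of "\<lambda>\<omega>. heads i \<omega> * heads j \<omega>"] heads_measurable[OF assms(3)]
    heads_measurable[OF assms(4)]
  by (simp add: heads_swap_coords)

lemma pair_moment_diag: "i \<ge> 1 \<Longrightarrow> pair_moment i i = pair_moment 1 1"
  using pair_moment_transpose[of 1 i i i] by simp

lemma pair_moment_offdiag:
  assumes "i \<ge> 1" "j \<ge> 1" "i \<noteq> j"
  shows "pair_moment i j = pair_moment 1 2"
proof -
  define k where "k = Transposition.transpose 1 i j"
  have k: "k \<ge> 1" "k \<noteq> 1" using assms by (auto simp: k_def Transposition.transpose_def split: if_splits)
  have "pair_moment i j = pair_moment 1 k"
    using pair_moment_transpose[of 1 i i j] assms by (simp add: k_def)
  also have "\<dots> = pair_moment 1 2"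
    using pair_moment_transpose[of 2 k 1 k] k by (simp add: Transposition.transpose_def)
  finally show ?thesis .
qed

text \<open>
  All pairs of distinct coordinates share one mixed moment, so its total contribution is a multiple
  of the square of the sum of the weights and disappears.
\<close>

lemma second_moment_contrast:
  assumes w: "(\<Sum>i=1..n. w i) = 0"
  shows "(\<integral>\<omega>. (\<Sum>i=1..n. w i * heads i \<omega>)\<^sup>2 \<partial>P) \<le> (\<Sum>i=1..n. (w i)\<^sup>2)"
proof -
  have "(\<integral>\<omega>. (\<Sum>i=1..n. w i * heads i \<omega>)\<^sup>2 \<partial>P) =
      (\<integral>\<omega>. (\<Sum>i=1..n. \<Sum>j=1..n. w i * w j * (heads i \<omega> * heads j \<omega>)) \<partial>P)"
    by (simp add: power2_eq_square sum_product mult_ac)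
  also have "\<dots> = (\<Sum>i=1..n. \<Sum>j=1..n. w i * w j * pair_moment i j)"
    unfolding pair_moment_def
    by (subst Bochner_Integration.integral_sum)
       (auto intro!: sum.cong Bochner_Integration.integrable_sum integrable_mult_right integrable_heads_pair
         simp: Bochner_Integration.integral_sum integrable_heads_pair)
  also have "\<dots> = (\<Sum>i=1..n. \<Sum>j=1..n. w i * w j * pair_moment 1 2 +
      (if i = j then (w i)\<^sup>2 * (pair_moment 1 1 - pair_moment 1 2) else 0))"
  proof (intro sum.cong refl)
    fix i j assume "i \<in> {1..n}" "j \<in> {1..n}"
    then show "w i * w j * pair_moment i j = w i * w j * pair_moment 1 2 +
        (if i = j then (w i)\<^sup>2 * (pair_moment 1 1 - pair_moment 1 2) else 0)"
      using pair_moment_diag[of i] pair_moment_offdiag[of i j]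
      by (auto simp: algebra_simps power2_eq_square)
  qed
  also have "\<dots> = (\<Sum>i=1..n. \<Sum>j=1..n. w i * w j * pair_moment 1 2) +
      (\<Sum>i=1..n. (w i)\<^sup>2 * (pair_moment 1 1 - pair_moment 1 2))"
    by (simp add: sum.distrib)
  also have "(\<Sum>i=1..n. \<Sum>j=1..n. w i * w j * pair_moment 1 2) = (\<Sum>i=1..n. w i) * (\<Sum>j=1..n. w j) * pair_moment 1 2"
    unfolding sum_product by (simp only: sum_distrib_right)
  also have "\<dots> = 0" using w by simp
  also have "0 + (\<Sum>i=1..n. (w i)\<^sup>2 * (pair_moment 1 1 - pair_moment 1 2)) =
      (pair_moment 1 1 - pair_moment 1 2) * (\<Sum>i=1..n. (w i)\<^sup>2)"
    by (simp only: sum_distrib_left mult.commute add_0)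
  also have "\<dots> \<le> 1 * (\<Sum>i=1..n. (w i)\<^sup>2)"
  proof (rule mult_right_mono)
    have "pair_moment 1 1 \<le> (\<integral>\<omega>. 1 \<partial>P)"
      unfolding pair_moment_def
      by (rule integral_mono) (auto intro: integrable_heads_pair mult_le_one heads_bounds)
    moreover have "0 \<le> pair_moment 1 2" unfolding pair_moment_def
      by (rule Bochner_Integration.integral_nonneg) (simp add: heads_bounds)
    ultimately show "pair_moment 1 1 - pair_moment 1 2 \<le> 1" by (simp add: prob_space)
  qed (simp add: sum_nonneg)
  finally show ?thesis by simp
qed

lemma empirical_increment_moment:
  assumes m: "1 \<le> m" "m \<le> n"
  shows "(\<integral>\<omega>. (empirical n {1} \<omega> - empirical m {1} \<omega>)\<^sup>2 \<partial>P) \<le> 1 / real m - 1 / real n"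
proof -
  define w where "w i = (if i \<le> m then 1 / real n - 1 / real m else 1 / real n)" for i
  have pos: "real m > 0" "real n > 0" using m by auto
  have split: "(\<Sum>i=1..n. f i) = (\<Sum>i=1..m. f i) + (\<Sum>i=Suc m..n. f i)" for f :: "nat \<Rightarrow> real"
  proof -
    have "{1..n} = {1..m} \<union> {Suc m..n}" "{1..m} \<inter> {Suc m..n} = {}" using m by auto
    then show ?thesis by (simp add: sum.union_disjoint)
  qed
  have emp: "empirical n {1} \<omega> - empirical m {1} \<omega> = (\<Sum>i=1..n. w i * heads i \<omega>)" for \<omega>
  proof -
    have "(\<Sum>i=1..n. w i * heads i \<omega>) = (\<Sum>i=1..m. (1 / real n - 1 / real m) * heads i \<omega>) + (\<Sum>i=Suc m..n. (1 / real n) * heads i \<omega>)"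
      unfolding split by (intro arg_cong2[where f = "(+)"] sum.cong) (auto simp: w_def)
    also have "\<dots> = (1 / real n - 1 / real m) * (\<Sum>i=1..m. heads i \<omega>) + (1 / real n) * (\<Sum>i=Suc m..n. heads i \<omega>)"
      by (simp only: sum_distrib_left)
    also have "\<dots> = empirical n {1} \<omega> - empirical m {1} \<omega>"
      unfolding empirical_heads split[of "\<lambda>i. heads i \<omega>"] by (simp only: divide_inverse ring_distribs) simp
    finally show ?thesis by simp
  qed
  have s1: "(\<Sum>i=1..n. w i) = real m * (1 / real n - 1 / real m) + (real n - real m) * (1 / real n)"
    unfolding split using m by (simp add: w_def of_nat_diff)
  have s2: "(\<Sum>i=1..n. (w i)\<^sup>2) = real m * (1 / real n - 1 / real m)\<^sup>2 + (real n - real m) * (1 / real n)\<^sup>2"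
    unfolding split using m by (simp add: w_def of_nat_diff)
  have "(\<Sum>i=1..n. w i) = 0" unfolding s1 using pos by (simp add: field_simps)
  from second_moment_contrast[OF this] show ?thesis
  proof -
    define u v where "u = 1 / real m" and "v = 1 / real n"
    have "real m * u = 1" "real n * v = 1" using pos by (simp_all add: u_def v_def)
    then have "real m * (v - u)\<^sup>2 + (real n - real m) * v\<^sup>2 = u - v" by algebra
    with \<open>(\<integral>\<omega>. (\<Sum>i=1..n. w i * heads i \<omega>)\<^sup>2 \<partial>P) \<le> (\<Sum>i=1..n. (w i)\<^sup>2)\<close>
    show ?thesis unfolding emp s2 u_def v_def by simp
  qed
qed

text \<open>
  The strong law for exchangeable indicators. With \<open>r = j + 1\<close> the increment between the cubes of \<open>r\<close> and
  \<open>r + 1\<close> has second moment at most \<open>3 / r ^ 4\<close>, hence mean absolute value at most \<open>4 / r\<^sup>2\<close>, and these bounds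
  are summable.
\<close>

lemma empirical_converges: "AE \<omega> in P. (\<lambda>n. empirical n {1} \<omega>) \<longlonglongrightarrow> freq \<omega>"
proof -
  define D where "D j \<omega> = empirical (Suc (Suc j) ^ 3) {1} \<omega> - empirical (Suc j ^ 3) {1} \<omega>" for j \<omega>
  have mD [measurable]: "D j \<in> borel_measurable P" for j unfolding D_def by measurable
  have Db: "\<bar>D j \<omega>\<bar> \<le> 1" for j \<omega>
    using empirical_bounds[of "Suc (Suc j) ^ 3" \<omega>] empirical_bounds[of "Suc j ^ 3" \<omega>] unfolding D_def abs_le_iff by linarith
  have iD: "integrable P (D j)" "integrable P (\<lambda>\<omega>. (D j \<omega>)\<^sup>2)" for j
    using Db by (auto intro!: integrable_const_bound[where B = 1] simp: abs_square_le_1)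
  have ED: "(\<integral>\<omega>. \<bar>D j \<omega>\<bar> \<partial>P) \<le> 4 * (1 / (real (Suc j))\<^sup>2)" for j
  proof -
    define r s where "r = real (Suc j)" and "s = real (Suc (Suc j))"
    have r: "r > 0" by (simp add: r_def)
    have "\<bar>D j \<omega>\<bar> \<le> r\<^sup>2 * (D j \<omega>)\<^sup>2 + 1 / r\<^sup>2" for \<omega>
    proof -
      \<comment> \<open>The scaling \<open>r\<close> balances the two terms of order \<open>r ^ (-2)\<close> in the mean.\<close>
      have "0 \<le> (r * \<bar>D j \<omega>\<bar> - 1 / r)\<^sup>2" by simp
      also have "\<dots> = r\<^sup>2 * (D j \<omega>)\<^sup>2 + 1 / r\<^sup>2 - 2 * \<bar>D j \<omega>\<bar>"
        using r by (simp add: power2_diff power_mult_distrib power_divide)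
      finally show ?thesis by linarith
    qed
    then have "(\<integral>\<omega>. \<bar>D j \<omega>\<bar> \<partial>P) \<le> (\<integral>\<omega>. r\<^sup>2 * (D j \<omega>)\<^sup>2 + 1 / r\<^sup>2 \<partial>P)"
      using iD by (intro integral_mono) auto
    also have "\<dots> = r\<^sup>2 * (\<integral>\<omega>. (D j \<omega>)\<^sup>2 \<partial>P) + 1 / r\<^sup>2"
      using iD by (simp add: prob_space)
    also have "(\<integral>\<omega>. (D j \<omega>)\<^sup>2 \<partial>P) \<le> 1 / real (Suc j ^ 3) - 1 / real (Suc (Suc j) ^ 3)"
      unfolding D_def by (rule empirical_increment_moment) (auto intro: power_mono simp del: power_Suc)
    also have "\<dots> = 1 / r ^ 3 - 1 / s ^ 3" by (simp add: r_def s_def)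
    also have "\<dots> \<le> 3 / r ^ 4"
    proof -
      have s: "s = r + 1" "s > 0" by (simp_all add: r_def s_def)
      have "1 / r ^ 3 - 1 / s ^ 3 = (s ^ 3 - r ^ 3) / (r ^ 3 * s ^ 3)"
        using r s(2) by (simp add: diff_frac_eq)
      also have "\<dots> \<le> (3 * s\<^sup>2) / (r ^ 3 * s ^ 3)"
        using r s(2) by (intro divide_right_mono) (auto simp: s(1) power2_eq_square power3_eq_cube algebra_simps)
      also have "\<dots> = 3 / (r ^ 3 * s)"
        using r s(2) by (simp add: power2_eq_square power3_eq_cube)
      also have "\<dots> \<le> 3 / (r ^ 3 * r)" using r s by (intro divide_left_mono mult_left_mono) auto
      also have "r ^ 3 * r = r ^ 4" by (simp add: power_numeral_reduce)
      finally show ?thesis .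
    qed
    finally have "(\<integral>\<omega>. \<bar>D j \<omega>\<bar> \<partial>P) \<le> r\<^sup>2 * (3 / r ^ 4) + 1 / r\<^sup>2" using r by simp
    also have "\<dots> = 4 * (1 / r\<^sup>2)" using r by (simp add: field_simps power_numeral_reduce)
    finally show ?thesis by (simp add: r_def)
  qed
  have summ: "summable (\<lambda>j. \<integral>\<omega>. \<bar>D j \<omega>\<bar> \<partial>P)"
  proof (rule summable_comparison_test')
    show "summable (\<lambda>j. 4 * (1 / (real (Suc j))\<^sup>2))"
      using inverse_squares_sums by (intro summable_mult) (auto simp: sums_iff add.commute)
  qed (use ED in auto)
  have "AE \<omega> in P. summable (\<lambda>j. \<bar>D j \<omega>\<bar>)"
  proof -
    have "(\<integral>\<^sup>+\<omega>. (\<Sum>j. ennreal \<bar>D j \<omega>\<bar>) \<partial>P) = (\<Sum>j. \<integral>\<^sup>+\<omega>. ennreal \<bar>D j \<omega>\<bar> \<partial>P)"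
      by (rule nn_integral_suminf) measurable
    also have "\<dots> = (\<Sum>j. ennreal (\<integral>\<omega>. \<bar>D j \<omega>\<bar> \<partial>P))"
      using iD by (intro suminf_cong nn_integral_eq_integral) auto
    also have "\<dots> = ennreal (\<Sum>j. \<integral>\<omega>. \<bar>D j \<omega>\<bar> \<partial>P)"
      using summ by (intro suminf_ennreal2) auto
    finally have "(\<integral>\<^sup>+\<omega>. (\<Sum>j. ennreal \<bar>D j \<omega>\<bar>) \<partial>P) \<noteq> \<infinity>" by simp
    then have "AE \<omega> in P. (\<Sum>j. ennreal \<bar>D j \<omega>\<bar>) \<noteq> \<infinity>"
      by (intro nn_integral_PInf_AE) measurable
    then show ?thesis by eventually_elim (auto intro: summable_suminf_not_top)
  qed
  then show ?thesis
  proof eventually_elim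
    case (elim \<omega>)
    then have s: "summable (\<lambda>j. D j \<omega>)" by (rule summable_rabs_cancel)
    have tel: "(\<Sum>j<n. D j \<omega>) = empirical (Suc n ^ 3) {1} \<omega> - empirical 1 {1} \<omega>" for n
      unfolding D_def using sum_lessThan_telescope[of "\<lambda>j. empirical (Suc j ^ 3) {1} \<omega>" n] by simp
    from s have "convergent (\<lambda>n. \<Sum>j<n. D j \<omega>)" by (simp add: summable_iff_convergent)
    then have "convergent (\<lambda>n. empirical (Suc n ^ 3) {1} \<omega>)"
      unfolding tel by (simp add: convergent_diff_const_right_iff)
    then show ?case by (rule empirical_convergent_of_cubes)
  qed
qed

section \<open>Prediction given the history\<close>

lemma freq_bounds: "AE \<omega> in P. 0 \<le> freq \<omega> \<and> freq \<omega> \<le> 1"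
  using empirical_converges
proof eventually_elim
  case (elim \<omega>)
  show ?case
    using LIMSEQ_le_const[OF elim, of 0] LIMSEQ_le_const2[OF elim, of 1] empirical_bounds[of _ \<omega>] by auto
qed

lemma integrable_freq_mult:
  assumes W: "integrable P W"
  shows "integrable P (\<lambda>\<omega>. freq \<omega> * W \<omega>)"
proof (rule Bochner_Integration.integrable_bound[OF W])
  show "AE \<omega> in P. norm (freq \<omega> * W \<omega>) \<le> norm (W \<omega>)"
    using freq_bounds by eventually_elim (simp add: abs_mult mult_left_le_one_le)
qed (use W in measurable)

text \<open>
  Swapping coordinate \<open>n + 1\<close> with any later \<open>j\<close> fixes \<open>W\<close>, so all coordinates after \<open>n\<close> have the same
  integral against \<open>W\<close>. Their average therefore has it too, and this average tends to the limiting
  frequency.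
\<close>

lemma integral_next_head:
  assumes W: "integrable P W"
    and inv: "\<And>j \<omega>. j > n \<Longrightarrow> \<omega> \<in> space P \<Longrightarrow> W (swap_coords (n + 1) j \<omega>) = W \<omega>"
  shows "(\<integral>\<omega>. heads (n + 1) \<omega> * W \<omega> \<partial>P) = (\<integral>\<omega>. freq \<omega> * W \<omega> \<partial>P)"
proof -
  have mW [measurable]: "W \<in> borel_measurable P" using W by simp
  have same: "(\<integral>\<omega>. heads j \<omega> * W \<omega> \<partial>P) = (\<integral>\<omega>. heads (n + 1) \<omega> * W \<omega> \<partial>P)" if j: "j > n" for j
  proof -
    have "(\<integral>\<omega>. heads (n + 1) \<omega> * W \<omega> \<partial>P) =
        (\<integral>\<omega>. heads (n + 1) (swap_coords (n + 1) j \<omega>) * W (swap_coords (n + 1) j \<omega>) \<partial>P)"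
      using integral_swap_coords[of "n + 1" j "\<lambda>\<omega>. heads (n + 1) \<omega> * W \<omega>"] j heads_measurable[of "n + 1"] mW
      by simp
    also have "\<dots> = (\<integral>\<omega>. heads j \<omega> * W \<omega> \<partial>P)"
      by (rule Bochner_Integration.integral_cong) (use inv[OF j] in \<open>auto simp: heads_swap_coords\<close>)
    finally show ?thesis by simp
  qed
  define A where "A N \<omega> = (\<Sum>j=n+1..n+Suc N. heads j \<omega>) / real (Suc N)" for N \<omega>
  have mA [measurable]: "A N \<in> borel_measurable P" for N
    unfolding A_def by (intro borel_measurable_divide borel_measurable_sum heads_measurable) auto
  have A01: "\<bar>A N \<omega>\<bar> \<le> 1" for N \<omega>
  proof -
    have "(\<Sum>j=n+1..n+Suc N. heads j \<omega>) \<le> real (card {n+1..n+Suc N}) * 1"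
      by (rule sum_bounded_above) (rule heads_bounds)
    moreover have "0 \<le> (\<Sum>j=n+1..n+Suc N. heads j \<omega>)" by (intro sum_nonneg heads_bounds)
    ultimately show ?thesis by (simp add: A_def divide_le_eq)
  qed
  have EA: "(\<integral>\<omega>. A N \<omega> * W \<omega> \<partial>P) = (\<integral>\<omega>. heads (n + 1) \<omega> * W \<omega> \<partial>P)" for N
  proof -
    have "(\<integral>\<omega>. A N \<omega> * W \<omega> \<partial>P) = (\<integral>\<omega>. (\<Sum>j=n+1..n+Suc N. heads j \<omega> * W \<omega>) / real (Suc N) \<partial>P)"
      by (simp only: A_def sum_distrib_right times_divide_eq_left)
    also have "\<dots> = (\<Sum>j=n+1..n+Suc N. \<integral>\<omega>. heads j \<omega> * W \<omega> \<partial>P) / real (Suc N)"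
      by (subst integral_divide_zero, subst Bochner_Integration.integral_sum)
         (auto intro: integrable_heads_mult[OF W])
    also have "(\<Sum>j=n+1..n+Suc N. \<integral>\<omega>. heads j \<omega> * W \<omega> \<partial>P) =
        (\<Sum>j=n+1..n+Suc N. \<integral>\<omega>. heads (n + 1) \<omega> * W \<omega> \<partial>P)"
      by (intro sum.cong refl same) auto
    finally show ?thesis by simp
  qed
  have "(\<lambda>N. \<integral>\<omega>. A N \<omega> * W \<omega> \<partial>P) \<longlonglongrightarrow> (\<integral>\<omega>. freq \<omega> * W \<omega> \<partial>P)"
  proof (rule integral_dominated_convergence[where w = "\<lambda>\<omega>. \<bar>W \<omega>\<bar>"])
    show "AE \<omega> in P. (\<lambda>N. A N \<omega> * W \<omega>) \<longlonglongrightarrow> freq \<omega> * W \<omega>"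
      using empirical_converges
    proof eventually_elim
      case (elim \<omega>)
      have A_eq: "A N \<omega> = (1 + real n / real (Suc N)) * empirical (n + Suc N) {1} \<omega> - (\<Sum>j=1..n. heads j \<omega>) / real (Suc N)" for N
      proof -
        have "{1..n + Suc N} = {1..n} \<union> {n+1..n+Suc N}" "{1..n} \<inter> {n+1..n+Suc N} = {}" by auto
        then have "(\<Sum>j=1..n+Suc N. heads j \<omega>) = (\<Sum>j=1..n. heads j \<omega>) + (\<Sum>j=n+1..n+Suc N. heads j \<omega>)"
          by (simp only: sum.union_disjoint finite_atLeastAtMost)
        moreover have "(1 + real n / real (Suc N)) * empirical (n + Suc N) {1} \<omega> = (\<Sum>j=1..n+Suc N. heads j \<omega>) / real (Suc N)"
        proof -
          have "1 + real n / real (Suc N) = real (n + Suc N) / real (Suc N)" by (simp add: field_simps)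
          then show ?thesis unfolding empirical_heads by simp
        qed
        ultimately show ?thesis unfolding A_def by (simp add: add_divide_distrib)
      qed
      have "(\<lambda>N. empirical (n + Suc N) {1} \<omega>) \<longlonglongrightarrow> freq \<omega>"
        using LIMSEQ_ignore_initial_segment[OF elim, of "Suc n"] by (simp add: add.commute)
      moreover have z: "(\<lambda>N. c / real (Suc N)) \<longlonglongrightarrow> 0" for c
        using LIMSEQ_Suc[OF lim_const_over_n] .
      ultimately have "(\<lambda>N. A N \<omega>) \<longlonglongrightarrow> (1 + 0) * freq \<omega> - 0"
        unfolding A_eq by (intro tendsto_intros)
      then show ?case by (intro tendsto_mult) auto
    qed
    show "AE \<omega> in P. norm (A N \<omega> * W \<omega>) \<le> \<bar>W \<omega>\<bar>" for N
      using A01 by (intro AE_I2) (auto simp: abs_mult intro: mult_left_le_one_le)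
  qed (use W in auto)
  then show ?thesis unfolding EA by (simp add: LIMSEQ_const_iff)
qed

lemma space_history [simp]: "space (history n) = space P"
  unfolding history_def by (subst space_measure_of) (auto simp: space_seq_space)

lemma sets_history:
  "sets (history n) = sigma_sets (space P) {proj i -` A \<inter> space P |i A. i \<in> {1..n} \<and> A \<subseteq> states}"
  unfolding history_def space_seq_space by (subst sets_measure_of) auto

lemma history_generator_measurable:
  "i \<ge> 1 \<Longrightarrow> A \<subseteq> states \<Longrightarrow> proj i -` A \<inter> space P \<in> sets P"
  using measurable_sets[OF coord_measurable, of i A] by (simp add: proj_def[abs_def])

lemma subalgebra_history: "subalgebra P (history n)"
  unfolding subalgebra_def space_history sets_history
  by (auto intro!: sets.sigma_sets_subset history_generator_measurable)

lemma sets_history_mono: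
  assumes "m \<le> n"
  shows "sets (history m) \<subseteq> sets (history n)"
  unfolding sets_history
proof (intro sigma_sets_mono' Collect_mono impI, elim exE conjE)
  fix X i A assume "X = proj i -` A \<inter> space P" "i \<in> {1..m}" "A \<subseteq> states"
  then show "\<exists>i A. X = proj i -` A \<inter> space P \<and> i \<in> {1..n} \<and> A \<subseteq> states"
    using assms by (intro exI[of _ i] exI[of _ A]) auto
qed

lemma sets_history_agree:
  assumes "A \<in> sets (history n)" "\<omega> \<in> space P" "\<omega>' \<in> space P" "\<And>i. i \<in> {1..n} \<Longrightarrow> \<omega> i = \<omega>' i"
  shows "\<omega> \<in> A \<longleftrightarrow> \<omega>' \<in> A"
  using assms(1) unfolding sets_history
  by (induction rule: sigma_sets.induct) (use assms(2-4) in \<open>auto simp: proj_def\<close>)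

lemma sets_P_history: "sets P = sigma_sets (space P) (\<Union>n. sets (history n))"
proof (rule antisym)
  show "sigma_sets (space P) (\<Union>n. sets (history n)) \<subseteq> sets P"
    using subalgebra_history by (intro sets.sigma_sets_subset) (auto simp: subalgebra_def)
  have "sets P = sigma_sets (space P) {{f \<in> space P. f i \<in> A} |i A. i \<in> {1..} \<and> A \<in> sets (count_space states)}"
    unfolding sets_P seq_space_def sets_PiM_single by (simp add: space_P)
  also have "\<dots> \<subseteq> sigma_sets (space P) (\<Union>n. sets (history n))"
  proof (rule sigma_sets_mono', rule subsetI)
    fix X assume "X \<in> {{f \<in> space P. f i \<in> A} |i A. i \<in> {1..} \<and> A \<in> sets (count_space states)}"
    then obtain i A where X: "X = {f \<in> space P. f i \<in> A}" and "i \<in> {1..}" "A \<in> sets (count_space states)"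
      by blast
    then have "proj i -` A \<inter> space P \<in> sets (history i)"
      unfolding sets_history by (intro sigma_sets.Basic) auto
    moreover have "X = proj i -` A \<inter> space P" by (auto simp: X proj_def)
    ultimately show "X \<in> (\<Union>n. sets (history n))" by auto
  qed
  finally show "sets P \<subseteq> sigma_sets (space P) (\<Union>n. sets (history n))" .
qed

sublocale filt: generating_filtration P history
  by unfold_locales (rule subalgebra_history sets_history_mono sets_P_history, assumption?)+

lemma heads_history_measurable:
  assumes "i \<in> {1..n}"
  shows "heads i \<in> borel_measurable (history n)"
proof -
  have "proj i -` {1} \<inter> space P \<in> sets (history n)"
    unfolding sets_history using assms by (intro sigma_sets.Basic) (auto simp: states_def)
  then have "indicator (proj i -` {1} \<inter> space P) \<in> borel_measurable (history n)" by simp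
  then show ?thesis
    by (rule measurable_cong[THEN iffD1, rotated]) (auto simp: heads_def indicator_def proj_def)
qed

text \<open>
  The next coordinate and the limiting frequency have the same integral over every event of the
  history.
\<close>

lemma predictive_heads: "AE \<omega> in P. predictive P n {1} \<omega> = real_cond_exp P (history n) freq \<omega>"
  unfolding predictive_def
proof (rule filt.sub.real_cond_exp_charact)
  have eq: "indicator {1} (proj (n + 1) \<omega>) = heads (n + 1) \<omega>" for \<omega> by (simp add: heads_def proj_def)
  have ifreq: "integrable P freq" using integrable_freq_mult[of "\<lambda>_. 1"] by simp
  show "integrable P (\<lambda>\<omega>. indicator {1} (proj (n + 1) \<omega>) :: real)"
    unfolding eq using integrable_heads_mult[of "\<lambda>_. 1" "n + 1"] by simp
  show "integrable P (real_cond_exp P (history n) freq)" using ifreq by (rule filt.sub.real_cond_exp_int)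
  fix A assume A: "A \<in> sets (history n)"
  then have "A \<in> sets P" using subalgebra_history by (auto simp: subalgebra_def)
  have "(\<integral>\<omega>. heads (n + 1) \<omega> * indicator A \<omega> \<partial>P) = (\<integral>\<omega>. freq \<omega> * indicator A \<omega> \<partial>P)"
  proof (rule integral_next_head)
    show "integrable P (indicat_real A)" using \<open>A \<in> sets P\<close> by (simp add: emeasure_eq_measure)
    fix j \<omega> assume j: "n < j" and \<omega>: "\<omega> \<in> space P"
    have "swap_coords (n + 1) j \<omega> \<in> A \<longleftrightarrow> \<omega> \<in> A"
    proof (rule sets_history_agree[OF A])
      show "swap_coords (n + 1) j \<omega> \<in> space P" using j \<omega> by (intro swap_coords_space) auto
    qed (use j \<omega> in \<open>auto simp: swap_coords_def Transposition.transpose_def\<close>)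
    then show "indicat_real A (swap_coords (n + 1) j \<omega>) = indicator A \<omega>" by (simp add: indicator_def)
  qed
  then have "(\<integral>\<omega>\<in>A. indicator {1} (proj (n + 1) \<omega>) \<partial>P) = (\<integral>\<omega>\<in>A. freq \<omega> \<partial>P)"
    unfolding eq set_lebesgue_integral_def by (simp add: mult.commute)
  also have "\<dots> = (\<integral>\<omega>\<in>A. real_cond_exp P (history n) freq \<omega> \<partial>P)"
    by (rule filt.sub.real_cond_exp_intA[OF ifreq A])
  finally show "(\<integral>\<omega>\<in>A. indicator {1} (proj (n + 1) \<omega>) \<partial>P) =
      (\<integral>\<omega>\<in>A. real_cond_exp P (history n) freq \<omega> \<partial>P)" .
qed simp


text \<open>
  For binary \<open>x\<close>, this is the indicator that the first \<open>n\<close> coordinates follow \<open>x\<close>. The product form lets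
  the coordinates be integrated out one at a time.
\<close>

definition cylinder :: "nat \<Rightarrow> (nat \<Rightarrow> nat) \<Rightarrow> (nat \<Rightarrow> nat) \<Rightarrow> real" where
  "cylinder n x \<omega> = (\<Prod>i=1..n. if x i = 1 then heads i \<omega> else 1 - heads i \<omega>)"

lemma cylinder_bounds: "0 \<le> cylinder n x \<omega>" "cylinder n x \<omega> \<le> 1"
  unfolding cylinder_def using heads_bounds by (auto intro!: prod_nonneg prod_le_1)

lemma cylinder_measurable [measurable]: "cylinder n x \<in> borel_measurable P"
  unfolding cylinder_def
proof (rule borel_measurable_prod)
  fix i assume "i \<in> {1..n}"
  then have [measurable]: "heads i \<in> borel_measurable P" by simp
  show "(\<lambda>\<omega>. if x i = 1 then heads i \<omega> else 1 - heads i \<omega>) \<in> borel_measurable P" by simp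
qed

lemma cylinder_swap_coords: "j > n \<Longrightarrow> cylinder n x (swap_coords (n + 1) j \<omega>) = cylinder n x \<omega>"
  unfolding cylinder_def by (intro prod.cong) (auto simp: heads_swap_coords Transposition.transpose_def)

lemma integrable_cylinder_mult:
  assumes W: "integrable P W"
  shows "integrable P (\<lambda>\<omega>. cylinder n x \<omega> * W \<omega>)"
proof (rule Bochner_Integration.integrable_bound[OF W])
  show "AE \<omega> in P. norm (cylinder n x \<omega> * W \<omega>) \<le> norm (W \<omega>)"
    by (intro AE_I2) (simp add: abs_mult mult_left_le_one_le cylinder_bounds)
qed (use W in measurable)

text \<open>
  De Finetti's representation: conditionally on the limiting frequency the coordinates behave like
  independent tosses of a coin with that bias. The last coordinate may be exchanged for \<open>freq\<close>, which
  is then absorbed into \<open>\<phi>\<close>.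
\<close>

lemma integral_cylinder:
  assumes "\<phi> \<in> borel_measurable borel" "integrable P (\<lambda>\<omega>. \<phi> (freq \<omega>))"
  shows "(\<integral>\<omega>. cylinder n x \<omega> * \<phi> (freq \<omega>) \<partial>P) =
    (\<integral>\<omega>. (\<Prod>i=1..n. if x i = 1 then freq \<omega> else 1 - freq \<omega>) * \<phi> (freq \<omega>) \<partial>P)"
  using assms
proof (induction n arbitrary: \<phi>)
  case 0
  then show ?case by (simp add: cylinder_def)
next
  case (Suc n)
  let ?W = "\<lambda>\<omega>. cylinder n x \<omega> * \<phi> (freq \<omega>)"
  have W: "integrable P ?W" by (rule integrable_cylinder_mult[OF Suc.prems(2)])
  have next_head: "(\<integral>\<omega>. heads (n + 1) \<omega> * ?W \<omega> \<partial>P) = (\<integral>\<omega>. freq \<omega> * ?W \<omega> \<partial>P)"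
    by (rule integral_next_head[OF W]) (simp add: cylinder_swap_coords freq_swap_coords del: One_nat_def add_Suc_right)
  have cS: "cylinder (Suc n) x \<omega> = cylinder n x \<omega> * (if x (n + 1) = 1 then heads (n + 1) \<omega> else 1 - heads (n + 1) \<omega>)" for \<omega>
    by (simp add: cylinder_def)
  define \<psi> where "\<psi> t = (if x (n + 1) = 1 then t else 1 - t) * \<phi> t" for t :: real
  have m\<psi>: "\<psi> \<in> borel_measurable borel" unfolding \<psi>_def using Suc.prems(1) by simp
  have i\<psi>: "integrable P (\<lambda>\<omega>. \<psi> (freq \<omega>))"
    unfolding \<psi>_def using integrable_freq_mult[OF Suc.prems(2)] Suc.prems(2)
    by (cases "x (n + 1) = 1") (auto simp: algebra_simps)
  have "(\<integral>\<omega>. cylinder (Suc n) x \<omega> * \<phi> (freq \<omega>) \<partial>P) = (\<integral>\<omega>. cylinder n x \<omega> * \<psi> (freq \<omega>) \<partial>P)"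
  proof (cases "x (n + 1) = 1")
    case True
    then show ?thesis using next_head unfolding cS \<psi>_def by (simp add: mult_ac)
  next
    case False
    have "(\<integral>\<omega>. cylinder (Suc n) x \<omega> * \<phi> (freq \<omega>) \<partial>P) = (\<integral>\<omega>. ?W \<omega> - heads (n + 1) \<omega> * ?W \<omega> \<partial>P)"
      unfolding cS using False by (simp add: algebra_simps)
    also have "\<dots> = (\<integral>\<omega>. ?W \<omega> - freq \<omega> * ?W \<omega> \<partial>P)"
      using W integrable_heads_mult[OF W, of "n + 1"] integrable_freq_mult[OF W] next_head by simp
    also have "\<dots> = (\<integral>\<omega>. cylinder n x \<omega> * \<psi> (freq \<omega>) \<partial>P)"
      unfolding \<psi>_def using False by (simp add: algebra_simps)
    finally show ?thesis .
  qed
  also have "\<dots> = (\<integral>\<omega>. (\<Prod>i=1..n. if x i = 1 then freq \<omega> else 1 - freq \<omega>) * \<psi> (freq \<omega>) \<partial>P)"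
    by (rule Suc.IH[OF m\<psi> i\<psi>])
  also have "\<dots> = (\<integral>\<omega>. (\<Prod>i=1..Suc n. if x i = 1 then freq \<omega> else 1 - freq \<omega>) * \<phi> (freq \<omega>) \<partial>P)"
    by (simp add: \<psi>_def mult.assoc)
  finally show ?case .
qed

lemma cylinder_eq_indicator:
  assumes x: "x \<in> {1..n} \<rightarrow>\<^sub>E states" and \<omega>: "\<omega> \<in> space P"
  shows "cylinder n x \<omega> = (if restrict \<omega> {1..n} = x then 1 else 0)"
proof -
  have st: "x i = 0 \<or> x i = 1" "\<omega> i = 0 \<or> \<omega> i = 1" if "i \<in> {1..n}" for i
    using that x \<omega> unfolding space_P by (auto simp: PiE_iff states_def)
  have fac: "(if x i = 1 then heads i \<omega> else 1 - heads i \<omega>) = of_bool (\<omega> i = x i)" if "i \<in> {1..n}" for i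
    using st[OF that] by (auto simp: heads_def)
  have eq: "restrict \<omega> {1..n} = x \<longleftrightarrow> (\<forall>i\<in>{1..n}. \<omega> i = x i)"
  proof
    assume "\<forall>i\<in>{1..n}. \<omega> i = x i"
    then show "restrict \<omega> {1..n} = x" using x by (auto simp: fun_eq_iff PiE_iff extensional_def)
  qed auto
  have "cylinder n x \<omega> = (\<Prod>i=1..n. of_bool (\<omega> i = x i))"
    unfolding cylinder_def by (rule prod.cong[OF refl fac])
  also have "\<dots> = (if \<forall>i\<in>{1..n}. \<omega> i = x i then 1 else 0)"
    by (auto intro!: prod.neutral)
  finally show ?thesis unfolding eq .
qed

lemma indicator_history_eq_sum_cylinder:
  assumes A: "A \<in> sets (history n)" and \<omega>: "\<omega> \<in> space P"
  shows "indicator A \<omega> = (\<Sum>x\<in>(\<lambda>\<omega>. restrict \<omega> {1..n}) ` A. cylinder n x \<omega>)"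
proof -
  let ?B = "(\<lambda>\<omega>. restrict \<omega> {1..n}) ` A"
  have AP: "A \<subseteq> space P" using sets.sets_into_space[OF A] by simp
  have B: "?B \<subseteq> {1..n} \<rightarrow>\<^sub>E states" using AP unfolding space_P by (auto simp: PiE_iff)
  have fin: "finite ?B"
    by (rule finite_subset[OF B]) (simp add: finite_PiE states_def)
  have "(\<Sum>x\<in>?B. cylinder n x \<omega>) = (\<Sum>x\<in>?B. if restrict \<omega> {1..n} = x then 1 else 0)"
    by (intro sum.cong refl cylinder_eq_indicator \<omega>) (use B in blast)
  also have "\<dots> = (if restrict \<omega> {1..n} \<in> ?B then 1 else 0)" using fin by simp
  also have "restrict \<omega> {1..n} \<in> ?B \<longleftrightarrow> \<omega> \<in> A"
  proof
    assume "restrict \<omega> {1..n} \<in> ?B"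
    then obtain \<omega>' where w: "\<omega>' \<in> A" "restrict \<omega> {1..n} = restrict \<omega>' {1..n}" by auto
    have "\<omega> i = \<omega>' i" if "i \<in> {1..n}" for i using fun_cong[OF w(2), of i] that by simp
    then show "\<omega> \<in> A" using sets_history_agree[OF A \<omega>, of \<omega>'] w(1) AP by auto
  qed auto
  finally show ?thesis by (simp only: indicator_def of_bool_def)
qed

text \<open>
  Both sides are compared on the cylinders of length \<open>n\<close>, whose finite unions exhaust the history. On
  a cylinder with \<open>k\<close> ones and \<open>l = n - k\<close> zeros the number of ones is the constant \<open>k\<close>, so after integrating out
  the coordinates the claim becomes the hypothesis on \<open>h\<close>.
\<close>

lemma score_identity:
  fixes a b :: real and h :: "real \<Rightarrow> real"
  assumes h [measurable]: "h \<in> borel_measurable borel" and ih: "integrable (distr P borel freq) h"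
    and score: "\<And>k l :: nat.
      (\<integral>x. x ^ k * (1 - x) ^ l * (real k + 1 - a - (real (k + l) + 2 - a - b) * x) \<partial>distr P borel freq)
        = - (\<integral>x. x ^ k * (1 - x) ^ l * h x \<partial>distr P borel freq)"
  shows "AE \<omega> in P. (\<Sum>i=1..n. heads i \<omega>) + 1 - a - (real n + 2 - a - b) * real_cond_exp P (history n) freq \<omega>
    = real_cond_exp P (history n) (\<lambda>\<omega>. - h (freq \<omega>)) \<omega>"
proof -
  let ?c = "real n + 2 - a - b"
  define S where "S \<omega> = (\<Sum>i=1..n. heads i \<omega>) + 1 - a" for \<omega>
  define \<Phi> where "\<Phi> \<omega> = S \<omega> - ?c * freq \<omega>" for \<omega>
  have ihf: "integrable P (\<lambda>\<omega>. h (freq \<omega>))"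
    using ih by (simp add: integrable_distr_eq)
  have ifreq: "integrable P freq" using integrable_freq_mult[of "\<lambda>_. 1"] by simp
  have iS: "integrable P S"
    unfolding S_def using integrable_heads_mult[of "\<lambda>_. 1"]
    by (intro Bochner_Integration.integrable_diff Bochner_Integration.integrable_add
         Bochner_Integration.integrable_sum) auto
  have mS: "S \<in> borel_measurable (history n)"
    unfolding S_def by (intro borel_measurable_diff borel_measurable_add borel_measurable_sum
      borel_measurable_const heads_history_measurable)
  have i\<Phi>: "integrable P \<Phi>" unfolding \<Phi>_def using iS ifreq by simp
  have cyl: "(\<integral>\<omega>. cylinder n x \<omega> * \<Phi> \<omega> \<partial>P) = (\<integral>\<omega>. cylinder n x \<omega> * (- h (freq \<omega>)) \<partial>P)"
    if x: "x \<in> {1..n} \<rightarrow>\<^sub>E states" for x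
  proof -
    define k where "k = card ({1..n} \<inter> {i. x i = 1})"
    define l where "l = card ({1..n} \<inter> - {i. x i = 1})"
    have "k + l = card ({1..n} \<inter> {i. x i = 1} \<union> {1..n} \<inter> - {i. x i = 1})"
      unfolding k_def l_def by (rule card_Un_disjoint[symmetric]) auto
    also have "{1..n} \<inter> {i. x i = 1} \<union> {1..n} \<inter> - {i. x i = 1} = {1..n}" by auto
    finally have kl: "k + l = n" by simp
    define \<phi> where "\<phi> t = real k + 1 - a - (real (k + l) + 2 - a - b) * t" for t :: real
    have prod: "(\<Prod>i=1..n. if x i = 1 then t else 1 - t) = t ^ k * (1 - t) ^ l" for t :: real
      by (simp add: prod.If_cases k_def l_def)
    have m\<phi> [measurable]: "\<phi> \<in> borel_measurable borel" unfolding \<phi>_def by measurable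
    have i\<phi>: "integrable P (\<lambda>\<omega>. \<phi> (freq \<omega>))" unfolding \<phi>_def using ifreq by simp
    have "(\<integral>\<omega>. cylinder n x \<omega> * \<Phi> \<omega> \<partial>P) = (\<integral>\<omega>. cylinder n x \<omega> * \<phi> (freq \<omega>) \<partial>P)"
    proof (rule Bochner_Integration.integral_cong[OF refl])
      fix \<omega> assume \<omega>: "\<omega> \<in> space P"
      show "cylinder n x \<omega> * \<Phi> \<omega> = cylinder n x \<omega> * \<phi> (freq \<omega>)"
      proof (cases "restrict \<omega> {1..n} = x")
        case True
        have "(\<Sum>i=1..n. heads i \<omega>) = (\<Sum>i=1..n. if x i = 1 then 1 else 0)"
          by (rule sum.cong) (auto simp: heads_def True[symmetric])
        also have "\<dots> = real k" by (simp add: sum.If_cases k_def)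
        finally show ?thesis by (simp add: \<Phi>_def S_def \<phi>_def kl)
      qed (simp add: cylinder_eq_indicator[OF x \<omega>])
    qed
    also have "\<dots> = (\<integral>\<omega>. freq \<omega> ^ k * (1 - freq \<omega>) ^ l * \<phi> (freq \<omega>) \<partial>P)"
      unfolding integral_cylinder[OF m\<phi> i\<phi>] prod ..
    also have "\<dots> = (\<integral>t. t ^ k * (1 - t) ^ l * \<phi> t \<partial>distr P borel freq)"
      by (subst integral_distr) auto
    also have "\<dots> = - (\<integral>t. t ^ k * (1 - t) ^ l * h t \<partial>distr P borel freq)"
      unfolding \<phi>_def by (rule score)
    also have "\<dots> = - (\<integral>\<omega>. freq \<omega> ^ k * (1 - freq \<omega>) ^ l * h (freq \<omega>) \<partial>P)"
      by (subst integral_distr) auto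
    also have "\<dots> = - (\<integral>\<omega>. cylinder n x \<omega> * h (freq \<omega>) \<partial>P)"
      unfolding integral_cylinder[OF h ihf] prod ..
    finally show ?thesis by simp
  qed
  have ineg: "integrable P (\<lambda>\<omega>. - h (freq \<omega>))" using ihf by simp
  have "AE \<omega> in P. real_cond_exp P (history n) \<Phi> \<omega> = real_cond_exp P (history n) (\<lambda>\<omega>. - h (freq \<omega>)) \<omega>"
  proof (rule filt.sub.real_cond_exp_charact[OF _ i\<Phi>])
    show "integrable P (real_cond_exp P (history n) (\<lambda>\<omega>. - h (freq \<omega>)))"
      using ineg by (rule filt.sub.real_cond_exp_int)
    fix A assume A: "A \<in> sets (history n)"
    let ?B = "(\<lambda>\<omega>. restrict \<omega> {1..n}) ` A"
    have B: "?B \<subseteq> {1..n} \<rightarrow>\<^sub>E states"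
      using sets.sets_into_space[OF A] unfolding space_history space_P by (auto simp: PiE_iff)
    have expand: "(\<integral>\<omega>\<in>A. W \<omega> \<partial>P) = (\<Sum>x\<in>?B. \<integral>\<omega>. cylinder n x \<omega> * W \<omega> \<partial>P)" if W: "integrable P W" for W :: "(nat \<Rightarrow> nat) \<Rightarrow> real"
    proof -
      have "(\<integral>\<omega>\<in>A. W \<omega> \<partial>P) = (\<integral>\<omega>. (\<Sum>x\<in>?B. cylinder n x \<omega> * W \<omega>) \<partial>P)"
        unfolding set_lebesgue_integral_def
        by (rule Bochner_Integration.integral_cong) (simp_all add: indicator_history_eq_sum_cylinder[OF A] sum_distrib_right)
      also have "\<dots> = (\<Sum>x\<in>?B. \<integral>\<omega>. cylinder n x \<omega> * W \<omega> \<partial>P)"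
        by (rule Bochner_Integration.integral_sum) (rule integrable_cylinder_mult[OF W])
      finally show ?thesis .
    qed
    have "(\<integral>\<omega>\<in>A. \<Phi> \<omega> \<partial>P) = (\<integral>\<omega>\<in>A. - h (freq \<omega>) \<partial>P)"
      unfolding expand[OF i\<Phi>] expand[OF ineg] using B by (intro sum.cong refl cyl) auto
    also have "\<dots> = (\<integral>\<omega>\<in>A. real_cond_exp P (history n) (\<lambda>\<omega>. - h (freq \<omega>)) \<omega> \<partial>P)"
      by (rule filt.sub.real_cond_exp_intA[OF ineg A])
    finally show "(\<integral>\<omega>\<in>A. \<Phi> \<omega> \<partial>P) = (\<integral>\<omega>\<in>A. real_cond_exp P (history n) (\<lambda>\<omega>. - h (freq \<omega>)) \<omega> \<partial>P)" .
  qed simp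
  moreover have "AE \<omega> in P. real_cond_exp P (history n) \<Phi> \<omega> =
      real_cond_exp P (history n) S \<omega> - real_cond_exp P (history n) (\<lambda>\<omega>. ?c * freq \<omega>) \<omega>"
    unfolding \<Phi>_def using ifreq by (intro filt.sub.real_cond_exp_diff iS) simp
  moreover have "AE \<omega> in P. real_cond_exp P (history n) S \<omega> = S \<omega>"
    by (rule filt.sub.real_cond_exp_F_meas[OF iS mS])
  moreover have "AE \<omega> in P. real_cond_exp P (history n) (\<lambda>\<omega>. ?c * freq \<omega>) \<omega> = ?c * real_cond_exp P (history n) freq \<omega>"
    by (rule filt.sub.real_cond_exp_cmult[OF ifreq])
  ultimately show ?thesis
    by eventually_elim (simp add: S_def)
qed

text \<open>
  The empty event and the whole space contribute nothing, and complementary events have opposite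
  deviations.
\<close>

lemma deviation_norm_eq:
  assumes n: "n \<ge> 1"
  shows "AE \<omega> in P. deviation_norm P n \<omega> =
    sqrt (real n) * \<bar>empirical n {1} \<omega> - real_cond_exp P (history n) freq \<omega>\<bar>"
proof -
  have meas: "(\<lambda>\<omega>. indicator B (proj i \<omega>) :: real) \<in> borel_measurable P" if "i \<ge> 1" for B :: "nat set" and i
    using measurable_compose[OF coord_measurable[OF that], of "indicator B" borel] by (simp add: proj_def)
  have ihead: "integrable P (heads (n + 1))" using integrable_heads_mult[of "\<lambda>_. 1" "n + 1"] by simp
  have st: "\<omega> i = 0 \<or> \<omega> i = 1" if "\<omega> \<in> space P" "i \<ge> 1" for \<omega> i
    using that unfolding space_P by (auto simp: PiE_iff states_def)
  have mh: "heads (n + 1) \<in> borel_measurable P" by (rule heads_measurable) simp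
  have ph: "predictive P n {1} = real_cond_exp P (history n) (heads (n + 1))"
    by (simp add: predictive_def heads_def[abs_def] proj_def)
  have p0: "AE \<omega> in P. predictive P n {} \<omega> = 0"
    unfolding predictive_def using filt.sub.real_cond_exp_F_meas[of "\<lambda>_. 0" n] by simp
  have p01: "AE \<omega> in P. predictive P n {0, 1} \<omega> = 1"
  proof -
    have "AE \<omega> in P. predictive P n {0, 1} \<omega> = real_cond_exp P (history n) (\<lambda>_. 1) \<omega>"
      unfolding predictive_def
      using st by (intro filt.sub.real_cond_exp_cong AE_I2 meas) (auto simp: proj_def indicator_def)
    moreover have "AE \<omega> in P. real_cond_exp P (history n) (\<lambda>_. 1) \<omega> = 1"
      by (rule filt.sub.real_cond_exp_F_meas) auto
    ultimately show ?thesis by eventually_elim simp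
  qed
  have pz: "AE \<omega> in P. predictive P n {0} \<omega> = 1 - predictive P n {1} \<omega>"
  proof -
    have "AE \<omega> in P. predictive P n {0} \<omega> = real_cond_exp P (history n) (\<lambda>\<omega>. 1 - heads (n + 1) \<omega>) \<omega>"
      unfolding predictive_def
    proof (intro filt.sub.real_cond_exp_cong AE_I2 meas)
      fix \<omega> assume "\<omega> \<in> space P"
      then show "indicator {0} (proj (n + 1) \<omega>) = 1 - heads (n + 1) \<omega>"
        using st[of \<omega> "n + 1"] by (auto simp: proj_def heads_def indicator_def)
    qed (use mh in auto)
    moreover have "AE \<omega> in P. real_cond_exp P (history n) (\<lambda>\<omega>. 1 - heads (n + 1) \<omega>) \<omega> =
        real_cond_exp P (history n) (\<lambda>_. 1) \<omega> - real_cond_exp P (history n) (heads (n + 1)) \<omega>"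
      by (rule filt.sub.real_cond_exp_diff) (use ihead in auto)
    moreover have "AE \<omega> in P. real_cond_exp P (history n) (\<lambda>_. 1) \<omega> = 1"
      by (rule filt.sub.real_cond_exp_F_meas) auto
    ultimately show ?thesis unfolding ph by eventually_elim simp
  qed
  have e0: "empirical n {} \<omega> = 0" for \<omega> by (simp add: empirical_def)
  have e01: "empirical n {0, 1} \<omega> = 1" and ez: "empirical n {0} \<omega> = 1 - empirical n {1} \<omega>"
    if \<omega>: "\<omega> \<in> space P" for \<omega>
  proof -
    have ind: "indicator {0, 1} (proj i \<omega>) = (1 :: real)"
      "indicator {0} (proj i \<omega>) = (1 - indicator {1} (proj i \<omega>) :: real)" if "i \<in> {1..n}" for i
      using st[OF \<omega>, of i] that by (auto simp: proj_def indicator_def)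
    have "(\<Sum>i=1..n. indicator {0, 1} (proj i \<omega>) :: real) = (\<Sum>i=1..n. 1)"
      by (rule sum.cong[OF refl ind(1)])
    then show "empirical n {0, 1} \<omega> = 1" using n by (simp add: empirical_def)
    have "(\<Sum>i=1..n. indicator {0} (proj i \<omega>) :: real) = (\<Sum>i=1..n. 1 - indicator {1} (proj i \<omega>))"
      by (rule sum.cong[OF refl ind(2)])
    then show "empirical n {0} \<omega> = 1 - empirical n {1} \<omega>"
      using n by (simp add: empirical_def sum_subtractf diff_divide_distrib)
  qed
  have Pow: "Pow states = {{}, {0}, {1}, {0, 1}}"
    unfolding states_def by (auto simp: Pow_insert)
  show ?thesis
    using p0 p01 pz predictive_heads[of n] AE_space
  proof eventually_elim
    case (elim \<omega>)
    define \<delta> where "\<delta> = sqrt (real n) * \<bar>empirical n {1} \<omega> - real_cond_exp P (history n) freq \<omega>\<bar>"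
    have "deviation P n {} \<omega> = 0" by (simp only: deviation_def elim(1) e0) simp
    moreover have "deviation P n {0, 1} \<omega> = 0"
      by (simp only: deviation_def elim(2) e01[OF elim(5)]) simp
    moreover have d1: "deviation P n {1} \<omega> =
        sqrt (real n) * (empirical n {1} \<omega> - real_cond_exp P (history n) freq \<omega>)"
      by (simp only: deviation_def elim(4))
    moreover have "deviation P n {0} \<omega> = - deviation P n {1} \<omega>"
      by (simp only: deviation_def elim(3) ez[OF elim(5)]) (simp add: algebra_simps)
    moreover have "\<bar>deviation P n {1} \<omega>\<bar> = \<delta>" by (simp only: d1 \<delta>_def abs_mult) simp
    ultimately have "(\<lambda>B. \<bar>deviation P n B \<omega>\<bar>) ` Pow states = {0, \<delta>}"
      unfolding Pow by auto
    moreover have "\<delta> \<ge> 0" by (simp add: \<delta>_def)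
    ultimately show ?case unfolding deviation_norm_def \<delta>_def[symmetric] by simp
  qed
qed

end

section \<open>Almost sure convergence of the rescaled deviations\<close>

theorem corollary5:
  fixes P :: "(nat \<Rightarrow> nat) measure" and \<pi> :: "real measure"
  assumes "prob_space P"
    and "sets P = sets seq_space"
    and "exchangeable P"
    and "\<pi> = distr P borel (limit_freq {1})"
    and "\<exists>f :: real \<Rightarrow> real. f \<in> borel_measurable borel \<and> (\<forall>x. 0 \<le> f x) \<and>
           \<pi> = density lborel (\<lambda>x. ennreal (f x)) \<and> almost_lipschitz f"
  shows "\<exists>V :: (nat \<Rightarrow> nat) \<Rightarrow> real. V \<in> borel_measurable P \<and>
           (AE \<omega> in P. (\<lambda>n. sqrt (real n) * deviation_norm P n \<omega>) \<longlonglongrightarrow> V \<omega>)"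
proof -
  interpret exchangeable_sequence P
    by (intro exchangeable_sequence.intro exchangeable_sequence_axioms.intro assms)
  from assms(5) obtain f where f: "f \<in> borel_measurable borel" "\<And>x. 0 \<le> f x"
    and \<pi>: "distr P borel freq = density lborel (\<lambda>x. ennreal (f x))" and "almost_lipschitz f"
    using assms(4) unfolding freq_def by auto
  from \<open>almost_lipschitz f\<close> obtain a b L where ab: "a < 1" "b < 1"
    and lip: "L-lipschitz_on {0<..<1} (\<lambda>x. f x * x powr a * (1 - x) powr b)"
    unfolding almost_lipschitz_def by blast
  have "AE x in distr P borel freq. x \<in> {0..1}"
    using freq_bounds by (subst AE_distr_iff) auto
  then have supp: "AE x in density lborel (\<lambda>x. ennreal (f x)). x \<in> {0..1}" unfolding \<pi> .
  have "\<exists>h :: real \<Rightarrow> real. h \<in> borel_measurable borel \<and> integrable (distr P borel freq) h \<and>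
    (\<forall>k l :: nat. (\<integral>x. x ^ k * (1 - x) ^ l * (real k + 1 - a - (real (k + l) + 2 - a - b) * x) \<partial>distr P borel freq)
        = - (\<integral>x. x ^ k * (1 - x) ^ l * h x \<partial>distr P borel freq))"
    unfolding \<pi> by (rule almost_lipschitz_score[OF f ab lip supp])
  then obtain h where h [measurable]: "h \<in> borel_measurable borel"
    and ih: "integrable (distr P borel freq) h"
    and score: "\<And>k l :: nat.
      (\<integral>x. x ^ k * (1 - x) ^ l * (real k + 1 - a - (real (k + l) + 2 - a - b) * x) \<partial>distr P borel freq)
        = - (\<integral>x. x ^ k * (1 - x) ^ l * h x \<partial>distr P borel freq)"
    by blast
  define V where "V \<omega> = \<bar>- h (freq \<omega>) - (1 - a) + (2 - a - b) * freq \<omega>\<bar>" for \<omega>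
  have ihf: "integrable P (\<lambda>\<omega>. - h (freq \<omega>))"
    using ih by (simp add: integrable_distr_eq)
  have ifreq: "integrable P freq" using integrable_freq_mult[of "\<lambda>_. 1"] by simp
  have "AE \<omega> in P. (\<lambda>n. sqrt (real n) * deviation_norm P n \<omega>) \<longlonglongrightarrow> V \<omega>"
  proof -
    have "AE \<omega> in P. \<forall>n. (\<Sum>i=1..n. heads i \<omega>) + 1 - a - (real n + 2 - a - b) * real_cond_exp P (history n) freq \<omega>
        = real_cond_exp P (history n) (\<lambda>\<omega>. - h (freq \<omega>)) \<omega>"
      unfolding AE_all_countable using score_identity[OF h ih score] by blast
    moreover have "AE \<omega> in P. \<forall>n. n \<ge> 1 \<longrightarrow> deviation_norm P n \<omega> =
        sqrt (real n) * \<bar>empirical n {1} \<omega> - real_cond_exp P (history n) freq \<omega>\<bar>"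
      unfolding AE_all_countable
    proof
      fix n :: nat
      show "AE \<omega> in P. n \<ge> 1 \<longrightarrow> deviation_norm P n \<omega> =
          sqrt (real n) * \<bar>empirical n {1} \<omega> - real_cond_exp P (history n) freq \<omega>\<bar>"
        by (cases "n \<ge> 1") (use deviation_norm_eq[of n] in simp_all)
    qed
    moreover note filt.cond_exp_converges[OF ihf] filt.cond_exp_converges[OF ifreq]
    ultimately show ?thesis
    proof eventually_elim
      case (elim \<omega>)
      let ?E = "\<lambda>n. real_cond_exp P (history n) freq \<omega>"
      let ?H = "\<lambda>n. real_cond_exp P (history n) (\<lambda>\<omega>. - h (freq \<omega>)) \<omega>"
      have "(\<lambda>n. \<bar>?H n - (1 - a) + (2 - a - b) * ?E n\<bar>) \<longlonglongrightarrow> V \<omega>"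
        unfolding V_def by (intro tendsto_intros elim)
      moreover have "eventually (\<lambda>n. \<bar>?H n - (1 - a) + (2 - a - b) * ?E n\<bar> = sqrt (real n) * deviation_norm P n \<omega>) sequentially"
        using eventually_ge_at_top[of 1]
      proof eventually_elim
        fix n :: nat assume n: "n \<ge> 1"
        \<comment> \<open>The score identity, solved for the deviation.\<close>
        have "?H n - (1 - a) + (2 - a - b) * ?E n = (\<Sum>i=1..n. heads i \<omega>) - real n * ?E n"
          using elim(1)[rule_format, of n] by (simp add: algebra_simps)
        also have "\<dots> = real n * (empirical n {1} \<omega> - ?E n)"
        proof -
          have "real n * empirical n {1} \<omega> = (\<Sum>i=1..n. heads i \<omega>)"
            unfolding empirical_heads using n by simp
          then show ?thesis by (simp only: right_diff_distrib)
        qed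
        finally have "\<bar>?H n - (1 - a) + (2 - a - b) * ?E n\<bar> = real n * \<bar>empirical n {1} \<omega> - ?E n\<bar>"
          by (simp add: abs_mult)
        then show "\<bar>?H n - (1 - a) + (2 - a - b) * ?E n\<bar> = sqrt (real n) * deviation_norm P n \<omega>"
          using elim(2) n by simp
      qed
      ultimately show ?case by (rule Lim_transform_eventually)
    qed
  qed
  moreover have "V \<in> borel_measurable P" unfolding V_def by measurable
  ultimately show ?thesis by blast
qed

end
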